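(* Let $n\in\mathbb{N}^+$ and let $K$ be a compact metric space with $\dim_T K\geq n$. Then for a generic $f\in C(K,\mathbb{R}^n)$ we have \[\dim_T\partial f(K)=\dim_H\partial f(K)=n-1.\] Moreover, let $h$ be a gauge function with $\lim_{r\to0+}h(r)/r^{n-1}=0$. Then for a generic $f\in C(K,\mathbb{R}^n)$ we have $\mathcal{H}^h(\partial f(K))=0$ and $\mathcal{H}^{n-1}(\partial f(K))>0$.
   Context: $\dim_T$ is the topological dimension (small inductive dimension: $\dim_T\emptyset=-1$ and $\dim_T X=\inf\{d: X$ has a basis $\mathcal{U}$ with $\dim_T\partial U\leq d-1$ for all $U\in\mathcal{U}\}$), $\dim_H$ is Hausdorff dimension. A gauge function is a non-decreasing function $h\colon[0,\infty)\to[0,\infty)$. The $h$-Hausdorff measure of a subset $A$ of a metric space is $\mathcal{H}^h(A)=\lim_{\delta\to0+}\mathcal{H}^h_\delta(A)$, where $\mathcal{H}^h_\delta(A)=\inf\{\sum_{i=1}^\infty h(\operatorname{diam}A_i):A\subset\bigcup_{i=1}^\infty A_i,\ \operatorname{diam}A_i\leq\delta\text{ for all }i\}$, with $\operatorname{diam}\emptyset=0$; $\mathcal{H}^s$ is the case $h(x)=x^s$ (convention $0^0=1$). $C(K,\mathbb{R}^n)$ is the complete metric space of continuous maps $K\to\mathbb{R}^n$ with the maximum norm. A property holds for a generic $f\in C(K,\mathbb{R}^n)$ if the set of $f$ having it is co-meager. $\partial f(K)$ is the boundary of $f(K)$ in $\mathbb{R}^n$. *)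

theory Defs
  imports "HOL-Analysis.Analysis"
begin

text \<open>
  \<^const>\<open>dimension_le\<close> is the recursion for the small inductive dimension, starting with
  dimension \<open>-1\<close> for the empty space. The infimum is \<open>\<infinity>\<close> if no integer bounds the dimension.
\<close>

definition small_ind_dim :: "'a topology \<Rightarrow> ereal" where
  "small_ind_dim X = (INF d \<in> {d::int. X dim_le d}. ereal (of_int d))"

abbreviation dim_T :: "'a::topological_space set \<Rightarrow> ereal" where
  "dim_T S \<equiv> small_ind_dim (top_of_set S)"

definition gauge_function :: "(real \<Rightarrow> real) \<Rightarrow> bool" where
  "gauge_function h \<longleftrightarrow> mono_on {0..} h \<and> (\<forall>x\<ge>0. 0 \<le> h x)"

text \<open>
  An empty set in the cover contributes \<open>0\<close>, so that finite covers are allowed even when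
  \<open>h 0 > 0\<close>. This only matters for such \<open>h\<close>; in particular it makes the measure for \<open>s = 0\<close>
  the counting measure. The boundedness condition is needed because \<^const>\<open>diameter\<close> is
  real-valued and meaningless on unbounded sets.
\<close>

definition hausdorff_premeasure ::
  "(real \<Rightarrow> real) \<Rightarrow> real \<Rightarrow> 'a::metric_space set \<Rightarrow> ennreal" where
  "hausdorff_premeasure h \<delta> S =
     Inf {(\<Sum>i. if A i = {} then 0 else ennreal (h (diameter (A i)))) | A :: nat \<Rightarrow> 'a set.
            S \<subseteq> (\<Union>i. A i) \<and> (\<forall>i. bounded (A i) \<and> diameter (A i) \<le> \<delta>)}"

definition hausdorff_measure :: "(real \<Rightarrow> real) \<Rightarrow> 'a::metric_space set \<Rightarrow> ennreal" where
  "hausdorff_measure h S = Lim (at_right 0) (\<lambda>\<delta>. hausdorff_premeasure h \<delta> S)"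

lemma hausdorff_premeasure_antimono:
  "\<delta> \<le> \<delta>' \<Longrightarrow> hausdorff_premeasure h \<delta>' S \<le> hausdorff_premeasure h \<delta> S"
  unfolding hausdorff_premeasure_def by (rule Inf_superset_mono) (auto intro: order_trans)

lemma tendsto_hausdorff_premeasure:
  "((\<lambda>\<delta>. hausdorff_premeasure h \<delta> S) \<longlongrightarrow> (SUP \<delta>\<in>{0<..}. hausdorff_premeasure h \<delta> S)) (at_right 0)"
proof (rule order_tendstoI)
  fix a assume "a < (SUP \<delta>\<in>{0<..}. hausdorff_premeasure h \<delta> S)"
  then obtain d where d: "d > 0" "a < hausdorff_premeasure h d S"
    by (auto simp: less_SUP_iff)
  show "\<forall>\<^sub>F \<delta> in at_right 0. a < hausdorff_premeasure h \<delta> S"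
    unfolding eventually_at_right_field
  proof (intro exI conjI allI impI)
    show "0 < d" by (fact d)
    show "a < hausdorff_premeasure h y S" if "y < d" for y
      using d(2) hausdorff_premeasure_antimono[of y d h S] that by simp
  qed
next
  fix a assume a: "(SUP \<delta>\<in>{0<..}. hausdorff_premeasure h \<delta> S) < a"
  show "\<forall>\<^sub>F \<delta> in at_right 0. hausdorff_premeasure h \<delta> S < a"
    unfolding eventually_at_right_field
    by (rule exI[of _ 1]) (auto intro: le_less_trans[OF SUP_upper a])
qed

lemma hausdorff_measure_eq_SUP:
  "hausdorff_measure h S = (SUP \<delta>\<in>{0<..}. hausdorff_premeasure h \<delta> S)"
  unfolding hausdorff_measure_def
  by (rule tendsto_Lim[OF _ tendsto_hausdorff_premeasure]) simp

text \<open>The case distinction implements \<open>0\<^sup>0 = 1\<close>, since \<open>0 powr 0 = 0\<close>.\<close>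

definition power_gauge :: "real \<Rightarrow> real \<Rightarrow> real" where
  "power_gauge s x = (if s = 0 then 1 else x powr s)"

definition dim_H :: "'a::metric_space set \<Rightarrow> ereal" where
  "dim_H S = (INF s \<in> {s. 0 \<le> s \<and> hausdorff_measure (power_gauge s) S = 0}. ereal s)"

definition nowhere_dense_in :: "'a topology \<Rightarrow> 'a set \<Rightarrow> bool" where
  "nowhere_dense_in X N \<longleftrightarrow> N \<subseteq> topspace X \<and> X interior_of (X closure_of N) = {}"

definition meager_in :: "'a topology \<Rightarrow> 'a set \<Rightarrow> bool" where
  "meager_in X S \<longleftrightarrow> (\<exists>\<N>. countable \<N> \<and> (\<forall>N\<in>\<N>. nowhere_dense_in X N) \<and> S = \<Union>\<N>)"

definition comeager_in :: "'a topology \<Rightarrow> 'a set \<Rightarrow> bool" where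
  "comeager_in X S \<longleftrightarrow> S \<subseteq> topspace X \<and> meager_in X (topspace X - S)"

text \<open>
  The space \<open>C(K,E)\<close> with the supremum metric. Its elements are the functions that are continuous
  on \<open>K\<close> and \<^const>\<open>undefined\<close> outside \<open>K\<close>; boundedness is automatic for compact \<open>K\<close>.
\<close>

definition cont_maps :: "'a::metric_space set \<Rightarrow> ('a \<Rightarrow> 'b::metric_space) metric" where
  "cont_maps K = cfunspace (top_of_set K) euclidean_metric"

definition generic_map ::
  "'a::metric_space set \<Rightarrow> (('a \<Rightarrow> 'b::metric_space) \<Rightarrow> bool) \<Rightarrow> bool" where
  "generic_map K P \<longleftrightarrow> comeager_in (mtopology_of (cont_maps K)) {f \<in> mspace (cont_maps K). P f}"

end

theory Submission
  imports Defs
begin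

text \<open>
  Upper bounds. Call a point \<open>c\<close> stable for \<open>f\<close> if it belongs to \<open>g(K)\<close> for all \<open>g\<close> close to \<open>f\<close>. After a
  small perturbation, the centre of each cell of a fine cubical grid is either stable for \<open>f\<close> or
  missed by \<open>f\<close>. Composing \<open>f\<close> with the map that blows up a small cube around every centre to its cell
  gives \<open>g\<close> such that, for \<open>u\<close> close to \<open>g\<close>, the set \<open>u(K)\<close> covers almost all of the stable cells and
  otherwise stays near the \<open>(n-1)\<close>-skeleton of the grid. The boundary of \<open>u(K)\<close> is therefore covered by
  \<open>O(\<tau>\<^sup>1\<^sup>-\<^sup>n)\<close> sets of diameter \<open>O(\<tau>)\<close> with \<open>\<tau>\<close> arbitrarily small. Being closed and nowhere dense,
  the boundary has topological dimension at most \<open>n - 1\<close>.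

  Lower bounds. If the maps into \<open>\<real>\<^sup>n\<close> that avoid \<open>0\<close> are dense on a compact space, then its small
  inductive dimension is less than \<open>n\<close>; applied to small balls in \<open>K\<close>, this shows that \<open>f(K)\<close> generically
  has interior points. Then the boundary has positive \<open>(n-1)\<close>-dimensional measure, because it projects
  onto the shadow of a ball. Its topological dimension is at least \<open>n - 1\<close>, because maps from a compact
  set of dimension at most \<open>n - 2\<close> into the \<open>(n-1)\<close>-sphere are null-homotopic, whereas the radial
  projection of the boundary from an interior point is not.
\<close>

section \<open>Upper bounds for the small inductive dimension\<close>

text \<open>Controlling finitely many points under perturbation is easy; the boundary estimate needs
  almost every point of a cell. The stretching closes this gap. Where \<open>g\<close> stretches
  \<open>f\<close> by the factor \<open>M\<close> around a centre \<open>c\<close>, the equation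
  \<open>u z = y'\<close> is solved by any \<open>z\<close> with \<open>v z = c\<close>, for a
  suitable perturbation \<open>v\<close> of \<open>f\<close> by \<open>(u - g) / M\<close> and a
  small constant vector. Stability of the single point \<open>c\<close> therefore places nearly the
  whole cell in \<open>u(K)\<close>.

  For the interior points, the frontiers in the recursion for the dimension must have no common
  point. They lie in zero sets of real functions, so one function from each of n stages forms a map
  into R^n that has to avoid 0. There are only countably many such selections, and Baire's theorem
  treats them all at once.

  The Hausdorff dimension needs no upper bound of its own: the gauges
  \<open>r^(n - 1 + 1/(k + 1))\<close> satisfy the condition imposed on \<open>h\<close>, and
  countably many of them suffice.\<close>

lemma frontier_of_openin_subset:
  assumes "openin X U" "closedin X C" "U \<subseteq> C"
  shows "X frontier_of U \<subseteq> C - U"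
proof -
  have "X closure_of U \<subseteq> C" using assms by (intro closure_of_minimal)
  moreover have "X interior_of U = U" using assms(1) by (rule interior_of_openin)
  ultimately show ?thesis by (auto simp: frontier_of_def)
qed

lemma frontier_of_subtopology_Int_subset:
  "subtopology X Y frontier_of (Y \<inter> W) \<subseteq> Y \<inter> X frontier_of W"
proof -
  have "subtopology X Y frontier_of (Y \<inter> W) = subtopology X Y frontier_of (topspace (subtopology X Y) \<inter> (Y \<inter> W))"
    by (rule frontier_of_restrict)
  also have "topspace (subtopology X Y) \<inter> (Y \<inter> W) = topspace (subtopology X Y) \<inter> W"
    by auto
  also have "subtopology X Y frontier_of \<dots> = subtopology X Y frontier_of W"
    by (rule frontier_of_restrict[symmetric])
  finally show ?thesis
    using frontier_of_subtopology_subset[of Y X W] frontier_of_subset_topspace[of "subtopology X Y" W]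
    by auto
qed

text \<open>
  Neighbourhoods are taken from a different base at each stage of the recursion for the dimension,
  so that no sum theorem is needed for the frontiers.
\<close>

lemma dimension_le_from_bases:
  fixes X :: "'a topology" and n :: nat
  assumes bases: "\<And>l V x. l < n \<Longrightarrow> openin X V \<Longrightarrow> x \<in> V \<Longrightarrow> \<exists>U\<in>B l. openin X U \<and> x \<in> U \<and> U \<subseteq> V"
    and disj: "\<And>U. (\<And>l. l < n \<Longrightarrow> U l \<in> B l) \<Longrightarrow> topspace X \<inter> (\<Inter>l<n. X frontier_of (U l)) = {}"
  shows "X dim_le (int n - 1)"
proof -
  \<comment> \<open>Downward induction on the number \<open>j\<close> of frontiers already
    intersected. At \<open>j = n\<close> the space is empty by \<open>disj\<close>; going from
    \<open>Suc j\<close> to \<open>j\<close> uses the base \<open>B j\<close> and raises the bound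
    by one.\<close>
  have "subtopology X (\<Inter>l<j. X frontier_of (U l)) dim_le (int n - 1 - int j)"
    if "j \<le> n" "\<And>l. l < j \<Longrightarrow> U l \<in> B l" for j U
    using that
  proof (induction j arbitrary: U rule: inc_induct)
    case base
    then have "subtopology X (\<Inter>l<n. X frontier_of (U l)) = trivial_topology"
      using disj[of U] by (simp add: subtopology_eq_discrete_topology_empty)
    then show ?case by simp
  next
    case (step j)
    let ?Y = "\<Inter>l<j. X frontier_of (U l)"
    show ?case
    proof (subst dimension_le_eq_subtopology, intro conjI allI impI)
      show "- 1 \<le> int n - 1 - int j" using step.hyps(2) by linarith
      fix V a assume a: "openin X V \<and> a \<in> V \<and> a \<in> ?Y"
      then obtain W where W: "W \<in> B j" "openin X W" "a \<in> W" "W \<subseteq> V"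
        using bases[of j V a] step.hyps(2) by auto
      let ?U = "U(j := W)"
      have *: "subtopology X (\<Inter>l<Suc j. X frontier_of (?U l)) dim_le (int n - 1 - int (Suc j))"
        by (rule step.IH) (use step.prems W in \<open>auto simp: less_Suc_eq\<close>)
      have "subtopology X ?Y frontier_of (?Y \<inter> W) \<subseteq> ?Y \<inter> X frontier_of W"
        by (rule frontier_of_subtopology_Int_subset)
      moreover have "(\<Inter>l<Suc j. X frontier_of (?U l)) = ?Y \<inter> X frontier_of W"
      proof -
        have "(\<Inter>l<j. X frontier_of (?U l)) = ?Y" by (intro INF_cong) auto
        then show ?thesis by (simp add: lessThan_Suc Int_commute)
      qed
      ultimately have "subtopology X ?Y frontier_of (?Y \<inter> W) \<subseteq> (\<Inter>l<Suc j. X frontier_of (?U l))"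
        by simp
      then have "subtopology X (subtopology X ?Y frontier_of (?Y \<inter> W)) dim_le (int n - 1 - int (Suc j))"
        using dimension_le_subtopologies[OF *] by blast
      then show "\<exists>U. a \<in> U \<and> U \<subseteq> V \<and> openin X U \<and>
            subtopology X (subtopology X ?Y frontier_of (?Y \<inter> U)) dim_le (int n - 1 - int j - 1)"
        using W by (intro exI[of _ W]) (auto simp: algebra_simps)
    qed
  qed
  from this[of 0] show ?thesis by simp
qed

lemma countable_vec_components:
  assumes "countable D"
  shows "countable {v::'a^'n. \<forall>i. v $ i \<in> D}"
proof -
  have "v \<in> vec_lambda ` (PiE UNIV (\<lambda>_. D))" if "\<forall>i. v $ i \<in> D" for v :: "'a^'n"
    using that by (intro image_eqI[of _ _ "\<lambda>i. v $ i"]) auto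
  then have "{v::'a^'n. \<forall>i. v $ i \<in> D} \<subseteq> vec_lambda ` (PiE UNIV (\<lambda>_. D))" by auto
  moreover have "countable (PiE (UNIV::'n set) (\<lambda>_. D))"
    using assms by (intro countable_PiE) auto
  ultimately show ?thesis
    by (meson countable_image countable_subset)
qed

text \<open>Cosets of the rationals by the multiples \<open>l * s\<close> of an irrational
  \<open>s\<close>. Stage \<open>l\<close> of the recursion takes the faces of its boxes from
  \<open>D l\<close>; disjointness makes different stages use different coordinates.\<close>

lemma disjoint_dense_countable_sets:
  obtains D :: "nat \<Rightarrow> real set"
  where "\<And>l. countable (D l)" "\<And>l a b. a < b \<Longrightarrow> \<exists>d\<in>D l. a < d \<and> d < b"
    "\<And>k l. k \<noteq> l \<Longrightarrow> D k \<inter> D l = {}"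
proof -
  obtain s :: real where s: "s \<notin> \<rat>"
  proof -
    have "\<rat> \<noteq> (UNIV :: real set)"
      using countable_rat uncountable_UNIV_real by metis
    then show ?thesis using that by auto
  qed
  define D where "D l = (\<lambda>q. q + real l * s) ` \<rat>" for l
  show thesis
  proof
    show "countable (D l)" for l
      unfolding D_def by (simp add: countable_rat)
    show "\<exists>d\<in>D l. a < d \<and> d < b" if "a < b" for l a b
      using Rats_dense_in_real[of "a - real l * s" "b - real l * s"] that
      unfolding D_def by (auto simp: algebra_simps)
    show "D k \<inter> D l = {}" if "k \<noteq> l" for k l
    proof (rule ccontr)
      assume "D k \<inter> D l \<noteq> {}"
      then obtain p q where pq: "p \<in> \<rat>" "q \<in> \<rat>" "p + real k * s = q + real l * s"
        unfolding D_def by auto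
      have "(real k - real l) * s = q - p"
        using pq(3) by (simp add: left_diff_distrib)
      then have "s = (q - p) / (real k - real l)"
        using that by (simp add: nonzero_eq_divide_eq mult.commute)
      then have "s \<in> \<rat>" using pq by simp
      then show False using s by simp
    qed
  qed
qed

text \<open>A point on the frontiers of one box from each of the n stages has, for every stage
  \<open>l\<close>, a coordinate in \<open>t + D l\<close>. These coordinates are distinct, hence
  exhaust all n, and the point lies in \<open>t + Q\<close> with \<open>Q\<close> countable. The
  shift \<open>t\<close> is chosen so that \<open>t + Q\<close> misses \<open>E\<close>.\<close>

lemma dimension_le_nowhere_dense:
  fixes E :: "(real^'n::finite) set"
  assumes "closed E" "interior E = {}"
  shows "top_of_set E dim_le (int CARD('n) - 1)"
proof -
  obtain D :: "nat \<Rightarrow> real set" where D: "\<And>l. countable (D l)"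
    "\<And>l a b. a < b \<Longrightarrow> \<exists>d\<in>D l. a < d \<and> d < b" "\<And>k l. k \<noteq> l \<Longrightarrow> D k \<inter> D l = {}"
    using disjoint_dense_countable_sets by metis
  define Q where "Q = {v::real^'n. \<forall>i. v $ i \<in> (\<Union>l. D l)}"
  have "countable Q"
    unfolding Q_def using D(1) by (intro countable_vec_components) auto
  \<comment> \<open>Each \<open>q\<close> excludes only the closed nowhere dense set
    \<open>E - q\<close> of shifts; Baire's theorem leaves a shift that no \<open>q\<close>
    excludes.\<close>
  have "UNIV \<subseteq> closure (\<Inter>((\<lambda>q. (+) (- q) ` (- E)) ` Q))"
  proof (rule Baire)
    fix T assume "T \<in> (\<lambda>q. (+) (- q) ` (- E)) ` Q"
    then obtain q where "T = (+) (- q) ` (- E)" by blast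
    then show "openin (top_of_set UNIV) T \<and> UNIV \<subseteq> closure T"
      using assms by (simp add: closure_translation open_translation closure_complement open_Compl
          del: uminus_add_conv_diff)
  qed (use \<open>countable Q\<close> in auto)
  then have "\<Inter>((\<lambda>q. (+) (- q) ` (- E)) ` Q) \<noteq> {}" 
    by (metis UNIV_not_empty closure_empty top.extremum_uniqueI)
  then obtain t where "t \<in> \<Inter>((\<lambda>q. (+) (- q) ` (- E)) ` Q)" by blast
  then have t: "t + q \<notin> E" if "q \<in> Q" for q
    using that by (auto simp: image_iff algebra_simps)
  define B where "B l = {E \<inter> box a b | a b. \<forall>i. a $ i - t $ i \<in> D l \<and> b $ i - t $ i \<in> D l}" for l
  show ?thesis
  proof (rule dimension_le_from_bases)
    fix l V x assume V: "openin (top_of_set E) V" "x \<in> V"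
    then obtain W where W: "open W" "V = E \<inter> W" unfolding openin_open by metis
    have "\<exists>a b. a - t $ i \<in> D l \<and> b - t $ i \<in> D l \<and> a < x $ i \<and> x $ i < b \<and> {a<..<b} \<subseteq> A"
      if A: "open A" "x $ i \<in> A" for A i
    proof -
      obtain e where e: "e > 0" "ball (x $ i) e \<subseteq> A" using openE[OF A] by metis
      obtain d where d: "d \<in> D l" "x $ i - e - t $ i < d" "d < x $ i - t $ i"
        using D(2)[of "x $ i - e - t $ i" "x $ i - t $ i" l] e(1) by auto
      obtain d' where d': "d' \<in> D l" "x $ i - t $ i < d'" "d' < x $ i + e - t $ i"
        using D(2)[of "x $ i - t $ i" "x $ i + e - t $ i" l] e(1) by auto
      have "{d + t $ i<..<d' + t $ i} \<subseteq> ball (x $ i) e"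
      proof
        fix y assume "y \<in> {d + t $ i<..<d' + t $ i}"
        with d d' show "y \<in> ball (x $ i) e" by (simp add: dist_real_def abs_less_iff)
      qed
      moreover have "d + t $ i < x $ i" "x $ i < d' + t $ i" using d d' by auto
      ultimately show ?thesis using e d(1) d'(1)
        by (intro exI[of _ "d + t $ i"] exI[of _ "d' + t $ i"]) simp
    qed
    moreover obtain A where A: "\<And>i. open (A i)" "\<And>i. x $ i \<in> A i" "\<And>y. (\<And>i. y $ i \<in> A i) \<Longrightarrow> y \<in> W"
    proof -
      have "x \<in> W" using W V by simp
      then have "\<exists>A. (\<forall>i. open (A i) \<and> x $ i \<in> A i) \<and> (\<forall>y. (\<forall>i. y $ i \<in> A i) \<longrightarrow> y \<in> W)"
        using W(1) unfolding open_vec_def by metis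
      then show thesis using that by metis
    qed
    ultimately have "\<forall>i. \<exists>a b. a - t $ i \<in> D l \<and> b - t $ i \<in> D l \<and> a < x $ i \<and> x $ i < b \<and> {a<..<b} \<subseteq> A i"
      by metis
    then obtain a b where ab: "\<And>i. a i - t $ i \<in> D l \<and> b i - t $ i \<in> D l \<and> a i < x $ i \<and> x $ i < b i \<and> {a i<..<b i} \<subseteq> A i"
      by metis
    have "E \<inter> box (vec_lambda a) (vec_lambda b) \<in> B l" unfolding B_def
      by (intro CollectI exI[of _ "vec_lambda a"] exI[of _ "vec_lambda b"]) (simp add: ab)
    moreover have "x \<in> E \<inter> box (vec_lambda a) (vec_lambda b)" 
      using V W ab by (auto simp: mem_box_cart)
    moreover have "E \<inter> box (vec_lambda a) (vec_lambda b) \<subseteq> V"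
    proof
      fix y assume "y \<in> E \<inter> box (vec_lambda a) (vec_lambda b)"
      then have "y \<in> E" "\<And>i. y $ i \<in> {a i<..<b i}" by (auto simp: mem_box_cart)
      then show "y \<in> V" unfolding W using A(3)[of y] ab by blast
    qed
    ultimately show "\<exists>U\<in>B l. openin (top_of_set E) U \<and> x \<in> U \<and> U \<subseteq> V"
      by (meson openin_open_Int open_box)
  next
    fix U assume U: "\<And>l. l < CARD('n) \<Longrightarrow> U l \<in> B l"
    show "topspace (top_of_set E) \<inter> (\<Inter>l<CARD('n). top_of_set E frontier_of (U l)) = {}"
    proof (rule ccontr)
      assume "\<not> ?thesis"
      then obtain x where x: "x \<in> E" "\<And>l. l < CARD('n) \<Longrightarrow> x \<in> top_of_set E frontier_of (U l)"
        by auto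
      have "\<exists>i. x $ i - t $ i \<in> D l" if l: "l < CARD('n)" for l
      proof -
        obtain a b where ab: "U l = E \<inter> box a b" "\<And>i. a $ i - t $ i \<in> D l" "\<And>i. b $ i - t $ i \<in> D l"
          using U[OF l] unfolding B_def by blast
        have "top_of_set E frontier_of (U l) \<subseteq> E \<inter> cbox a b - E \<inter> box a b"
          unfolding ab(1)
        proof (rule frontier_of_openin_subset)
          show "E \<inter> box a b \<subseteq> E \<inter> cbox a b" using box_subset_cbox by blast
        qed (intro openin_open_Int closedin_closed_Int open_box closed_cbox)+
        then have "x \<in> cbox a b" "x \<notin> box a b" using x(1) x(2)[OF l] by auto
        then have cb: "\<And>i. a $ i \<le> x $ i \<and> x $ i \<le> b $ i" and nb: "\<not> (\<forall>i. a $ i < x $ i \<and> x $ i < b $ i)"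
          by (auto simp: mem_box_cart)
        from nb obtain i where "\<not> (a $ i < x $ i \<and> x $ i < b $ i)" by blast
        then have "x $ i = a $ i \<or> x $ i = b $ i" using cb[of i] by linarith
        then show ?thesis using ab by metis
      qed
      then obtain i where i: "\<And>l. l < CARD('n) \<Longrightarrow> x $ (i l) - t $ (i l) \<in> D l" by metis
      \<comment> \<open>At a coordinate shared by two stages, \<open>x - t\<close> would lie in two
        disjoint sets \<open>D l\<close>. With as many stages as coordinates, \<open>i\<close> is
        then onto.\<close>
      have "inj_on i {..<CARD('n)}"
        using i D(3) by (metis (no_types, lifting) IntI empty_iff inj_onI lessThan_iff)
      then have "i ` {..<CARD('n)} = UNIV"
        by (metis card_image card_lessThan card_subset_eq finite subset_UNIV)
      then have im: "\<exists>l<CARD('n). j = i l" for j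
        by (metis UNIV_I image_iff lessThan_iff)
      have "x $ j - t $ j \<in> (\<Union>l. D l)" for j
        using im[of j] i by blast
      then have "x - t \<in> Q" unfolding Q_def by simp
      then show False using t[of "x - t"] x(1) by simp
    qed
  qed
qed

text \<open>A set inside \<open>ball x r\<close> that is open in \<open>K \<inter> cball x r\<close>
  is open in \<open>K\<close>, and its frontier in \<open>K\<close> is contained in its frontier in
  the closed ball. So a bound on one closed ball around each point is a bound for
  \<open>K\<close>.\<close>

lemma dim_le_localize:
  fixes K :: "'a::metric_space set"
  assumes nd: "\<not> top_of_set K dim_le d" and d: "-1 \<le> d"
  shows "\<exists>x\<in>K. \<forall>r>0. \<not> top_of_set (K \<inter> cball x r) dim_le d"
proof (rule ccontr)
  assume neg: "\<not> ?thesis"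
  have "top_of_set K dim_le d"
  proof (rule dimension_le.intros[OF d])
    fix V x assume V: "openin (top_of_set K) V" "x \<in> V"
    then have "x \<in> K" using openin_imp_subset by blast
    then obtain r where r: "r > 0" "top_of_set (K \<inter> cball x r) dim_le d"
      using neg by blast
    let ?L = "K \<inter> cball x r"
    have "openin (top_of_set ?L) (V \<inter> ball x r)"
    proof -
      obtain W where W: "open W" "V = K \<inter> W" using V unfolding openin_open by metis
      have "V \<inter> ball x r = ?L \<inter> (W \<inter> ball x r)" unfolding W by auto
      then show ?thesis using W(1) openin_open_Int[of "W \<inter> ball x r" ?L] by auto
    qed
    moreover have "x \<in> V \<inter> ball x r" using V r by simp
    ultimately obtain U where U: "x \<in> U" "U \<subseteq> V \<inter> ball x r" "openin (top_of_set ?L) U"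
        "subtopology (top_of_set ?L) (top_of_set ?L frontier_of U) dim_le d - 1"
      using r(2) unfolding dimension_le.simps[of "top_of_set ?L" d] by blast
    obtain W where W: "open W" "U = ?L \<inter> W" using U(3) unfolding openin_open by metis
    have "U = K \<inter> (W \<inter> ball x r)" using W(2) U(2) by auto
    then have oU: "openin (top_of_set K) U" using W(1) openin_open_Int[of "W \<inter> ball x r" K] by auto
    have "top_of_set K frontier_of U \<subseteq> ?L - U"
    proof (rule frontier_of_openin_subset[OF oU])
      have "ball x r \<subseteq> cball x r" by (rule ball_subset_cball)
      then show "U \<subseteq> ?L" using U(2) openin_imp_subset[OF V(1)] by blast
    qed (simp add: closedin_closed_Int)
    then have frL: "top_of_set K frontier_of U \<subseteq> ?L" by blast
    have "top_of_set K frontier_of U \<subseteq> top_of_set ?L frontier_of U"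
    proof
      fix y assume y: "y \<in> top_of_set K frontier_of U"
      then have "y \<in> closure (K \<inter> U)" "y \<notin> U" "y \<in> ?L" using frL
        by (auto simp: frontier_of_def interior_of_openin[OF oU] closure_of_subtopology)
      moreover have "K \<inter> U = U" "?L \<inter> U = U" using W(2) by auto
      ultimately show "y \<in> top_of_set ?L frontier_of U"
        by (simp add: frontier_of_def interior_of_openin[OF U(3)] closure_of_subtopology)
    qed
    then have "subtopology euclidean (?L \<inter> (top_of_set K frontier_of U)) dim_le d - 1"
      using dimension_le_subtopologies[OF U(4)] by (metis subtopology_subtopology)
    moreover have "?L \<inter> (top_of_set K frontier_of U) = K \<inter> (top_of_set K frontier_of U)"
      using frL by auto
    ultimately have "subtopology (top_of_set K) (top_of_set K frontier_of U) dim_le d - 1"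
      by (simp add: subtopology_subtopology)
    then show "\<exists>U. x \<in> U \<and> U \<subseteq> V \<and> openin (top_of_set K) U \<and>
           subtopology (top_of_set K) (top_of_set K frontier_of U) dim_le d - 1"
      using U oU by blast
  qed
  then show False using nd by simp
qed

section \<open>Small inductive dimension and maps that avoid a point\<close>

lemma openin_mtopology_of_iff:
  "openin (mtopology_of m) U \<longleftrightarrow> U \<subseteq> mspace m \<and>
    (\<forall>f\<in>U. \<exists>r>0. \<forall>g\<in>mspace m. mdist m f g < r \<longrightarrow> g \<in> U)"
proof -
  interpret Metric_space "mspace m" "mdist m" by (rule Metric_space_mspace_mdist)
  show ?thesis
    unfolding mtopology_of_def openin_mtopology by (fastforce simp: subset_iff)
qed

lemma dense_mtopology_of_iff:
  assumes "U \<subseteq> mspace m"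
  shows "mtopology_of m closure_of U = mspace m \<longleftrightarrow>
    (\<forall>f\<in>mspace m. \<forall>r>0. \<exists>g\<in>U. mdist m f g < r)"
proof -
  interpret Metric_space "mspace m" "mdist m" by (rule Metric_space_mspace_mdist)
  show ?thesis
    unfolding mtopology_of_def metric_closure_of using assms by (fastforce simp: subset_iff)
qed

lemma mcomplete_cfunspace_euclidean:
  "mcomplete_of (cfunspace X (euclidean_metric :: 'b::complete_space metric))"
proof -
  have "Met_TC.Self = (euclidean_metric :: 'b metric)"
    by (simp add: euclidean_metric_def Met_TC.Self_def)
  then show ?thesis
    using Met_TC.mcomplete_cfunspace[where 'a='b, of X] complete_UNIV[where 'a='b] by simp
qed

lemma mspace_cfunspace_euclidean:
  "f \<in> mspace (cfunspace X euclidean_metric) \<longleftrightarrow>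
    f \<in> extensional (topspace X) \<and> bounded (f ` topspace X) \<and> continuous_map X euclidean f"
  by auto

text \<open>Turns a whole family of functions into one element of a complete function space, so that
  a single application of Baire's theorem perturbs all of them.\<close>

lemma continuous_map_prod_discrete:
  assumes "\<And>i. i \<in> I \<Longrightarrow> continuous_map X Y (\<lambda>x. f (x, i))"
  shows "continuous_map (prod_topology X (discrete_topology I)) Y f"
  unfolding continuous_map_eq_topcontinuous_at topcontinuous_at_def
proof (intro ballI conjI allI impI)
  fix z assume z: "z \<in> topspace (prod_topology X (discrete_topology I))"
  obtain x i where xi: "z = (x, i)" "x \<in> topspace X" "i \<in> I" using z by auto
  note ci = assms[OF xi(3)]
  show "z \<in> topspace (prod_topology X (discrete_topology I))" by fact
  show "f \<in> topspace (prod_topology X (discrete_topology I)) \<rightarrow> topspace Y"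
  proof
    fix y assume "y \<in> topspace (prod_topology X (discrete_topology I))"
    then obtain x' j where xj: "y = (x', j)" "x' \<in> topspace X" "j \<in> I" by auto
    then show "f y \<in> topspace Y"
      using continuous_map_image_subset_topspace[OF assms[OF xj(3)]] by auto
  qed
  fix V assume V: "openin Y V \<and> f z \<in> V"
  let ?U = "{x \<in> topspace X. f (x, i) \<in> V}"
  have "openin X ?U" using ci V by (simp add: continuous_map)
  then have "openin (prod_topology X (discrete_topology I)) (?U \<times> {i})"
    by (simp add: openin_prod_Times_iff xi)
  then show "\<exists>U. openin (prod_topology X (discrete_topology I)) U \<and> z \<in> U \<and> (\<forall>y\<in>U. f y \<in> V)"
    using xi V by (intro exI[of _ "?U \<times> {i}"]) auto
qed

lemma compact_countable_dense:
  fixes L :: "'a::metric_space set"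
  assumes "compact L"
  shows "\<exists>E. countable E \<and> (\<forall>x\<in>L. \<forall>e>0. \<exists>y\<in>E. dist x y < e)"
proof -
  have "\<exists>k. finite k \<and> L \<subseteq> (\<Union>y\<in>k. ball y (1 / real (Suc m)))" for m
    using assms unfolding compact_eq_totally_bounded by simp
  then obtain k where k: "\<And>m. finite (k m)" "\<And>m. L \<subseteq> (\<Union>y\<in>k m. ball y (1 / real (Suc m)))"
    by metis
  show ?thesis
  proof (intro exI[of _ "\<Union>m. k m"] conjI ballI allI impI)
    show "countable (\<Union>m. k m)" using k(1) by (simp add: countable_finite)
    fix x and e :: real assume "x \<in> L" "e > 0"
    then obtain m where m: "1 / real (Suc m) < e" using nat_approx_posE by metis
    from k(2)[of m] \<open>x \<in> L\<close> obtain y where "y \<in> k m" "x \<in> ball y (1 / real (Suc m))" by blast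
    then have "dist x y < e" using m by (simp add: dist_commute)
    then show "\<exists>y\<in>\<Union>m. k m. dist x y < e" using \<open>y \<in> k m\<close> by blast
  qed
qed

lemma continuous_map_discrete_component:
  assumes "continuous_map (prod_topology X (discrete_topology I)) Y f" "i \<in> I"
  shows "continuous_map X Y (\<lambda>x. f (x, i))"
proof -
  have "continuous_map X (prod_topology X (discrete_topology I)) (\<lambda>x. (x, i))"
    using assms(2) by (simp add: continuous_map_paired)
  then show ?thesis
    using continuous_map_compose[OF _ assms(1)] by (simp add: o_def)
qed

text \<open>
  The sets \<open>{x. v (x, (l, e, m)) < 0}\<close> are the bases required above, where \<open>v\<close> is a generic function
  close to \<open>w\<close>, and \<open>w (x, (l, e, m))\<close> is a truncation of \<open>m * dist x e - 2\<close>.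
\<close>

lemma dim_le_if_zero_avoidable:
  fixes L :: "'a::metric_space set"
  assumes L: "compact L"
    and avoid: "\<And>(f::'a \<Rightarrow> real^'n::finite) e. continuous_on L f \<Longrightarrow> e > 0 \<Longrightarrow>
      \<exists>g. continuous_on L g \<and> (\<forall>x\<in>L. dist (g x) (f x) < e \<and> g x \<noteq> 0)"
  shows "top_of_set L dim_le (int CARD('n) - 1)"
proof -
  let ?N = "CARD('n)"
  obtain E where E: "countable E" "E \<noteq> {}" "\<And>x e. x \<in> L \<Longrightarrow> e > 0 \<Longrightarrow> \<exists>y\<in>E. dist x y < e"
  proof -
    obtain E where "countable E" "\<forall>x\<in>L. \<forall>e>0. \<exists>y\<in>E. dist x y < e"
      using compact_countable_dense[OF L] by blast
    then show thesis by (intro that[of "insert undefined E"]) auto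
  qed
  \<comment> \<open>An index in \<open>I\<close> is a stage \<open>l\<close> with a centre
    \<open>e\<close> and a scale \<open>m\<close>; it stands for a neighbourhood of \<open>e\<close>
    of radius about \<open>1 / m\<close>.\<close>
  define J where "J = E \<times> (UNIV :: nat set)"
  have cJ: "countable J" using E(1) by (simp add: J_def)
  define I where "I = {..<?N} \<times> J"
  define X where "X = prod_topology (top_of_set L) (discrete_topology I)"
  define M where "M = cfunspace X (euclidean_metric :: real metric)"
  have tX: "topspace X = L \<times> I" by (simp add: X_def)
  have inM: "v \<in> mspace M \<longleftrightarrow> v \<in> extensional (L \<times> I) \<and> bounded (v ` (L \<times> I)) \<and>
      (\<forall>i\<in>I. continuous_on L (\<lambda>x. v (x, i)))" for v
    unfolding M_def mspace_cfunspace_euclidean tX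
    using continuous_map_prod_discrete[of I "top_of_set L" euclidean v]
      continuous_map_discrete_component[of "top_of_set L" I euclidean v]
    by (auto simp: X_def)
  \<comment> \<open>A choice \<open>c\<close> picks one function per stage, that is, one map into
    R^n, and \<open>\<O> c\<close> asks this map to avoid 0. Compactness of \<open>L\<close> makes
    the condition open, \<open>avoid\<close> makes it dense, and there are only countably many
    \<open>c\<close>.\<close>
  define \<O> where "\<O> c = {v \<in> mspace M. \<forall>x\<in>L. \<exists>l<?N. v (x, (l, c l)) \<noteq> 0}" for c
  let ?C = "PiE {..<?N} (\<lambda>_. J)"
  have cC: "countable ?C" using cJ by (intro countable_PiE) auto
  have dlt: "dist (u z) (v z) < r" if "mdist M u v < r" "u \<in> mspace M" "v \<in> mspace M" "z \<in> L \<times> I" for u v z r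
    using mdist_cfunspace_imp_mdist_le[of u X "euclidean_metric" v "mdist M u v" z] that
    unfolding M_def tX by simp
  have op: "openin (mtopology_of M) (\<O> c)" if c: "c \<in> ?C" for c
    unfolding openin_mtopology_of_iff
  proof (intro conjI ballI)
    show "\<O> c \<subseteq> mspace M" by (auto simp: \<O>_def)
    fix v assume v: "v \<in> \<O> c"
    have inI: "(l, c l) \<in> I" if "l < ?N" for l using c that by (auto simp: I_def)
    define q where "q x = (\<Sum>l<?N. \<bar>v (x, (l, c l))\<bar>)" for x
    have "continuous_on L (\<lambda>x. v (x, (l, c l)))" if "l < ?N" for l
      using v inI[OF that] by (simp add: \<O>_def inM)
    then have cq: "continuous_on L q" unfolding q_def
      by (intro continuous_intros) auto
    have q0: "q x > 0" if x: "x \<in> L" for x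
    proof -
      obtain l where l: "l < ?N" "v (x, (l, c l)) \<noteq> 0" using v x by (auto simp: \<O>_def)
      then show ?thesis unfolding q_def by (intro sum_pos2[of _ l]) auto
    qed
    obtain d where d: "d > 0" "\<And>x. x \<in> L \<Longrightarrow> d \<le> q x"
    proof (cases "L = {}")
      case True
      then show ?thesis using that[of 1] by simp
    next
      case False
      obtain z where "z \<in> L" "\<And>x. x \<in> L \<Longrightarrow> q z \<le> q x"
        using continuous_attains_inf[OF L False cq] by blast
      then show ?thesis using q0 that[of "q z"] by blast
    qed
    show "\<exists>r>0. \<forall>g\<in>mspace M. mdist M v g < r \<longrightarrow> g \<in> \<O> c"
    proof (intro exI[of _ "d / real ?N"] conjI ballI impI)
      show "d / real ?N > 0" using d(1) by simp
      fix g assume g: "g \<in> mspace M" "mdist M v g < d / real ?N"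
      have "\<exists>l<?N. g (x, (l, c l)) \<noteq> 0" if x: "x \<in> L" for x
      proof (rule ccontr)
        assume no: "\<not> ?thesis"
        have "\<bar>v (x, (l, c l))\<bar> < d / real ?N" if l: "l < ?N" for l
        proof -
          have "dist (v (x, (l, c l))) (g (x, (l, c l))) < d / real ?N"
            using dlt[OF g(2) _ g(1)] v x inI[OF l] by (auto simp: \<O>_def)
          moreover have "g (x, (l, c l)) = 0" using no l by blast
          ultimately show ?thesis by simp
        qed
        then have "q x < (\<Sum>l<?N. d / real ?N)"
          unfolding q_def by (intro sum_strict_mono) (auto simp: lessThan_empty_iff)
        also have "\<dots> = d" by simp
        finally show False using d(2)[OF x] by simp
      qed
      then show "g \<in> \<O> c" using g(1) by (simp add: \<O>_def)
    qed
  qed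
  have dens: "mtopology_of M closure_of (\<O> c) = mspace M" if c: "c \<in> ?C" for c
  proof -
    have sub: "\<O> c \<subseteq> mspace M" by (auto simp: \<O>_def)
    show ?thesis unfolding dense_mtopology_of_iff[OF sub]
    proof (intro ballI allI impI)
      fix v and r :: real assume v: "v \<in> mspace M" and r: "r > 0"
      obtain b :: "'n \<Rightarrow> nat" where b: "bij_betw b UNIV {..<?N}"
        using ex_bij_betw_finite_nat[of "UNIV :: 'n set"] by (auto simp: atLeast0LessThan)
      have bl: "b i < ?N" for i using b by (auto simp: bij_betw_def)
      have inI: "(l, c l) \<in> I" if "l < ?N" for l using c that by (auto simp: I_def)
      define f where "f x = (\<chi> i. v (x, (b i, c (b i))))" for x
      have "continuous_on L f" unfolding f_def
        using v inI bl by (intro continuous_intros) (auto simp: inM)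
      then obtain g where g: "continuous_on L g" "\<And>x. x \<in> L \<Longrightarrow> dist (g x) (f x) < r / 2" "\<And>x. x \<in> L \<Longrightarrow> g x \<noteq> 0"
        using avoid[of f "r/2"] r by auto
      \<comment> \<open>Only the slices selected by \<open>c\<close> are replaced, by the components
        of \<open>g\<close>; so \<open>u\<close> stays within \<open>r / 2\<close> of
        \<open>v\<close>.\<close>
      define u where "u = (\<lambda>z\<in>L\<times>I. if snd (snd z) = c (fst (snd z)) then g (fst z) $ (inv b (fst (snd z))) else v z)"
      have ub: "u (x, (b i, c (b i))) = g x $ i" if "x \<in> L" for x i
        using that inI[OF bl] b by (simp add: u_def bij_betw_def inv_f_f)
      have du: "dist (u z) (v z) \<le> r / 2" if z: "z \<in> L \<times> I" for z
      proof -
        obtain x l p where zz: "z = (x, (l, p))" "x \<in> L" "l < ?N" "p \<in> J" using z by (auto simp: I_def)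
        show ?thesis
        proof (cases "p = c l")
          case True
          obtain i where i: "l = b i" using b zz(3) by (auto simp: bij_betw_def)
          have "dist (u z) (v z) = dist (g x $ i) (f x $ i)"
            using ub[OF zz(2), of i] True i zz by (simp add: f_def)
          also have "\<dots> \<le> dist (g x) (f x)" by (rule dist_vec_nth_le)
          finally show ?thesis using g(2)[OF zz(2)] by linarith
        next
          case False
          then show ?thesis using z zz r by (simp add: u_def)
        qed
      qed
      have "u \<in> mspace M"
        unfolding inM
      proof (intro conjI ballI)
        show "u \<in> extensional (L \<times> I)" by (simp add: u_def)
        obtain B where B: "\<And>z. z \<in> L \<times> I \<Longrightarrow> norm (v z) \<le> B"
          using v unfolding inM bounded_iff by blast
        have "norm (u z) \<le> B + r / 2" if "z \<in> L \<times> I" for z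
          using du[OF that] B[OF that] unfolding dist_real_def real_norm_def by linarith
        then show "bounded (u ` (L \<times> I))" unfolding bounded_iff by blast
        fix i assume i: "i \<in> I"
        show "continuous_on L (\<lambda>x. u (x, i))"
        proof (cases "snd i = c (fst i)")
          case True
          then have "continuous_on L (\<lambda>x. u (x, i)) \<longleftrightarrow> continuous_on L (\<lambda>x. g x $ (inv b (fst i)))"
            using i by (intro continuous_on_cong) (auto simp: u_def)
          then show ?thesis using g(1) by (simp add: continuous_intros)
        next
          case False
          then have "continuous_on L (\<lambda>x. u (x, i)) \<longleftrightarrow> continuous_on L (\<lambda>x. v (x, i))"
            using i by (intro continuous_on_cong) (auto simp: u_def)
          then show ?thesis using v i by (simp add: inM)
        qed
      qed
      moreover have "\<exists>l<?N. u (x, (l, c l)) \<noteq> 0" if x: "x \<in> L" for x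
      proof -
        obtain i where "g x $ i \<noteq> 0" using g(3)[OF x] by (auto simp: vec_eq_iff)
        then show ?thesis using ub[OF x, of i] bl[of i] by metis
      qed
      moreover have "mdist M v u < r"
      proof -
        have "mdist M v u \<le> r / 2" unfolding M_def
          by (rule mdist_cfunspace_le) (use r du in \<open>auto simp: tX dist_commute\<close>)
        then show ?thesis using r by simp
      qed
      ultimately show "\<exists>u\<in>\<O> c. mdist M v u < r" by (auto simp: \<O>_def)
    qed
  qed
  \<comment> \<open>Any \<open>v\<close> at distance less than 1 from \<open>w\<close> is negative
    where \<open>m * dist x e < 1\<close> and positive where \<open>m * dist x e \<ge> 3\<close>.
    The truncation at 2 bounds \<open>w\<close> uniformly in \<open>m\<close>, as membership in
    \<open>M\<close> requires.\<close>
  define w where "w = (\<lambda>z\<in>L\<times>I. min (real (snd (snd (snd z))) * dist (fst z) (fst (snd (snd z))) - 2) 2)"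
  have "w \<in> mspace M" unfolding inM
  proof (intro conjI ballI)
    show "w \<in> extensional (L \<times> I)" by (simp add: w_def)
    have "norm (w z) \<le> 2" if "z \<in> L \<times> I" for z
    proof -
      have "norm (min (a - 2) 2) \<le> 2" if "a \<ge> 0" for a :: real
        using that by (simp add: min_def abs_le_iff)
      then show ?thesis using that by (simp only: w_def restrict_apply' mult_nonneg_nonneg of_nat_0_le_iff zero_le_dist)
    qed
    then show "bounded (w ` (L \<times> I))" unfolding bounded_iff by blast
    fix i assume i: "i \<in> I"
    have "continuous_on L (\<lambda>x. w (x, i)) \<longleftrightarrow> continuous_on L (\<lambda>x. min (real (snd (snd i)) * dist x (fst (snd i)) - 2) 2)"
      using i by (intro continuous_on_cong) (auto simp: w_def)
    then show "continuous_on L (\<lambda>x. w (x, i))" by (simp add: continuous_intros)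
  qed
  moreover have "mtopology_of M closure_of \<Inter>(\<O> ` ?C) = mspace M"
  proof -
    interpret Metric_space "mspace M" "mdist M" by (rule Metric_space_mspace_mdist)
    show ?thesis
      unfolding mtopology_of_def
    proof (rule metric_Baire_category)
      show mcomplete 
        using mcomplete_cfunspace_euclidean[where 'b=real] unfolding M_def mcomplete_of_def by blast
      show "countable (\<O> ` ?C)" using cC by simp
    qed (use op dens in \<open>auto simp: mtopology_of_def\<close>)
  qed
  moreover have "\<Inter>(\<O> ` ?C) \<subseteq> mspace M"
  proof -
    have "?C \<noteq> {}" using E(2) by (auto simp: J_def PiE_eq_empty_iff)
    then obtain c where "c \<in> ?C" by blast
    then have "\<Inter>(\<O> ` ?C) \<subseteq> \<O> c" by (rule INT_lower)
    then show ?thesis by (auto simp: \<O>_def)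
  qed
  ultimately obtain v where v: "v \<in> \<Inter>(\<O> ` ?C)" "mdist M w v < 1" "v \<in> mspace M"
    using dense_mtopology_of_iff[of "\<Inter>(\<O> ` ?C)" M] zero_less_one by blast
  define B where "B l = {{x \<in> L. v (x, (l, p)) < 0} | p. p \<in> J}" for l
  have cv: "continuous_on L (\<lambda>x. v (x, i))" if "i \<in> I" for i
    using v(3) that by (simp add: inM)
  have vw: "\<bar>v z - w z\<bar> < 1" if "z \<in> L \<times> I" for z
    using dlt[OF v(2) \<open>w \<in> mspace M\<close> v(3) that] by (simp add: dist_real_def abs_minus_commute)
  have oU: "openin (top_of_set L) {x \<in> L. v (x, i) < 0}" if i: "i \<in> I" for i
  proof -
    have "openin (top_of_set L) (L \<inter> (\<lambda>x. v (x, i)) -` {..<0})"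
      using cv[OF i] by (intro continuous_openin_preimage_gen) auto
    moreover have "L \<inter> (\<lambda>x. v (x, i)) -` {..<0} = {x \<in> L. v (x, i) < 0}" by auto
    ultimately show ?thesis by simp
  qed
  have cU: "closedin (top_of_set L) {x \<in> L. v (x, i) \<le> 0}" if i: "i \<in> I" for i
  proof -
    have "closedin (top_of_set L) (L \<inter> (\<lambda>x. v (x, i)) -` {..0})"
      using cv[OF i] by (intro continuous_closedin_preimage) auto
    moreover have "L \<inter> (\<lambda>x. v (x, i)) -` {..0} = {x \<in> L. v (x, i) \<le> 0}" by auto
    ultimately show ?thesis by simp
  qed
  show ?thesis
  proof (rule dimension_le_from_bases)
    fix l V x assume l: "l < ?N" and V: "openin (top_of_set L) V" "x \<in> V"
    obtain W where W: "open W" "V = L \<inter> W" using V(1) unfolding openin_open by metis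
    have xL: "x \<in> L" "x \<in> W" using V(2) W(2) by auto
    obtain r where r: "r > 0" "ball x r \<subseteq> W" using openE[OF W(1) xL(2)] by metis
    \<comment> \<open>The 4 is 1 + 3: \<open>m * dist x e < 1\<close> for the chosen centre and
      \<open>m * dist y e < 3\<close> on the basic set, whence \<open>dist x y < r\<close>.\<close>
    obtain m0 where "1 / real (Suc m0) < r / 4" using nat_approx_posE[of "r/4"] r(1) by auto
    define m where "m = Suc m0"
    have m: "real m > 0" "4 < real m * r" using \<open>1 / real (Suc m0) < r / 4\<close> unfolding m_def by (auto simp: field_simps)
    obtain e where e: "e \<in> E" "dist x e < 1 / real m" using E(3)[OF xL(1), of "1 / real m"] m(1) by auto
    have me: "real m * dist x e < 1" using e(2) m(1) by (simp add: field_simps)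
    define i where "i = (l, (e, m))"
    have i: "i \<in> I" using l e by (simp add: i_def I_def J_def)
    define U where "U = {x \<in> L. v (x, i) < 0}"
    have "U \<in> B l" unfolding U_def B_def i_def using e by (auto simp: J_def)
    moreover have "openin (top_of_set L) U" unfolding U_def using oU[OF i] .
    moreover have "x \<in> U"
    proof -
      have "w (x, i) < - 1" using me xL i by (simp add: w_def i_def)
      then show ?thesis using vw[of "(x, i)"] xL i by (simp add: U_def abs_less_iff)
    qed
    moreover have "U \<subseteq> V"
    proof
      fix y assume "y \<in> U"
      then have y: "y \<in> L" "v (y, i) < 0" by (auto simp: U_def)
      then have "w (y, i) < 1" using vw[of "(y, i)"] i by (simp add: abs_less_iff)
      then have "real m * dist y e < 3" using y i by (simp add: w_def i_def min_def split: if_splits)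
      moreover have "real m * dist x y \<le> real m * (dist x e + dist y e)"
        using m(1) dist_triangle2[of x y e] by (intro mult_left_mono) auto
      ultimately have "real m * dist x y < real m * r" using me m(2) by (simp add: distrib_left)
      then have "dist x y < r" using m(1) by simp
      then show "y \<in> V" using r(2) W(2) y(1) by auto
    qed
    ultimately show "\<exists>U\<in>B l. openin (top_of_set L) U \<and> x \<in> U \<and> U \<subseteq> V" by blast
  next
    fix U assume U: "\<And>l. l < ?N \<Longrightarrow> U l \<in> B l"
    then have "\<forall>l\<in>{..<?N}. \<exists>p. p \<in> J \<and> U l = {x \<in> L. v (x, (l, p)) < 0}" unfolding B_def by blast
    then obtain c0 where c0: "\<forall>l\<in>{..<?N}. c0 l \<in> J \<and> U l = {x \<in> L. v (x, (l, c0 l)) < 0}"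
      by (rule bchoice[THEN exE])
    define c where "c = restrict c0 {..<?N}"
    have c: "c \<in> ?C" "\<And>l. l < ?N \<Longrightarrow> U l = {x \<in> L. v (x, (l, c l)) < 0}" using c0 by (auto simp: c_def)
    have "v \<in> \<O> c" using v(1) c(1) by blast
    \<comment> \<open>Each frontier lies in the zero set of its function, and the functions picked
      by \<open>c\<close> have no common zero.\<close>
    have "\<exists>l<?N. x \<notin> top_of_set L frontier_of (U l)" if x: "x \<in> L" for x
    proof -
      obtain l where l: "l < ?N" "v (x, (l, c l)) \<noteq> 0" using \<open>v \<in> \<O> c\<close> x by (auto simp: \<O>_def)
      have i: "(l, c l) \<in> I" using l(1) c(1) by (auto simp: I_def)
      have "top_of_set L frontier_of (U l) \<subseteq> {x \<in> L. v (x, (l, c l)) \<le> 0} - {x \<in> L. v (x, (l, c l)) < 0}"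
        unfolding c(2)[OF l(1)] by (rule frontier_of_openin_subset[OF oU[OF i] cU[OF i]]) auto
      then have "x \<notin> top_of_set L frontier_of (U l)" using l(2) by auto
      then show ?thesis using l(1) by blast
    qed
    then show "topspace (top_of_set L) \<inter> (\<Inter>l<?N. top_of_set L frontier_of (U l)) = {}" by auto
  qed
qed

section \<open>Maps from low-dimensional sets into spheres\<close>

text \<open>The cube is kept as a face inside the full space, so that an induction that changes the
  number of its coordinates does not change the type.\<close>

definition coord_cube :: "'n set \<Rightarrow> (real^'n::finite) set" where
  "coord_cube J = cbox 0 (\<chi> i. if i \<in> J then 1 else 0)"

lemma in_coord_cube:
  "x \<in> coord_cube J \<longleftrightarrow> (\<forall>i. (i \<in> J \<longrightarrow> 0 \<le> x $ i \<and> x $ i \<le> 1) \<and> (i \<notin> J \<longrightarrow> x $ i = 0))"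
proof -
  have "(0 \<le> x $ i \<and> x $ i \<le> (if i \<in> J then 1 else 0)) \<longleftrightarrow>
      (i \<in> J \<longrightarrow> 0 \<le> x $ i \<and> x $ i \<le> 1) \<and> (i \<notin> J \<longrightarrow> x $ i = 0)" for i
    by (cases "i \<in> J") auto
  then show ?thesis by (simp add: coord_cube_def mem_box_cart)
qed

lemma compact_coord_cube: "compact (coord_cube J)"
  by (simp add: coord_cube_def)

lemma aff_dim_coord_cube:
  fixes J :: "'n::finite set"
  assumes "j \<notin> J"
  shows "aff_dim (coord_cube J) < int CARD('n)"
proof -
  have "coord_cube J \<subseteq> {x. axis j 1 \<bullet> x = 0}"
    using assms by (auto simp: in_coord_cube inner_axis' dest!: spec[of _ j])
  then have "aff_dim (coord_cube J) \<le> aff_dim {x :: real^'n. axis j 1 \<bullet> x = 0}"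
    by (rule aff_dim_subset)
  also have "\<dots> = int CARD('n) - 1"
    by (subst aff_dim_hyperplane) (simp_all add: axis_eq_0_iff)
  finally show ?thesis by simp
qed

lemma continuous_on_glue_closed:
  assumes "closed S" "closed T" "continuous_on S f" "continuous_on T g"
    "\<And>x. x \<in> S \<Longrightarrow> x \<in> T \<Longrightarrow> f x = g x"
  shows "continuous_on (S \<union> T) (\<lambda>x. if x \<in> S then f x else g x)"
  using assms by (intro continuous_on_cases) auto

text \<open>The cube lacks the coordinate \<open>j\<close>, so its dimension is below n and maps
  from closed subsets of it into the (n-1)-sphere extend to the cube. This gives an extension over
  \<open>{x} \<times> coord_cube J\<close>; since the sphere is an ANR it extends further to a
  neighbourhood, which contains a tube because the cube is compact.\<close>

lemma sphere_extension_to_point: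
  fixes A :: "('a::euclidean_space \<times> (real^'n::finite)) set" and f :: "'a \<times> (real^'n) \<Rightarrow> real^'n"
  assumes "closed A" "continuous_on A f" "f ` A \<subseteq> sphere 0 1" "j \<notin> J"
  shows "\<exists>r>0. \<exists>g. continuous_on (A \<union> cball x r \<times> coord_cube J) g \<and>
    g ` (A \<union> cball x r \<times> coord_cube J) \<subseteq> sphere 0 1 \<and> (\<forall>z\<in>A. g z = f z)"
proof -
  let ?Q = "coord_cube J"
  have cQ: "compact ?Q" by (rule compact_coord_cube)
  then have clQ: "closed ?Q" by (rule compact_imp_closed)
  define A' where "A' = ?Q \<inter> Pair x -` A"
  have "closed A'" unfolding A'_def
    using assms(1) clQ by (intro continuous_closed_preimage continuous_intros)
  moreover have "continuous_on A' (\<lambda>q. f (x, q))"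
    by (rule continuous_on_compose2[OF assms(2)]) (auto simp: A'_def intro!: continuous_intros)
  moreover have "(\<lambda>q. f (x, q)) \<in> A' \<rightarrow> rel_frontier (cball (0::real^'n) 1)"
    using assms(3) by (auto simp: A'_def rel_frontier_cball image_subset_iff)
  moreover have "polytope ?Q" by (simp add: coord_cube_def polytope_interval)
  moreover have "aff_dim ?Q < aff_dim (cball (0::real^'n) 1)"
    using aff_dim_coord_cube[OF assms(4)] by (simp add: aff_dim_cball)
  moreover have "A' \<subseteq> \<Union>{?Q}" by (auto simp: A'_def)
  moreover have "?Q face_of ?Q" by (simp add: face_of_refl coord_cube_def)
  ultimately obtain g' where g': "continuous_on (\<Union>{?Q}) g'" "g' \<in> \<Union>{?Q} \<rightarrow> rel_frontier (cball (0::real^'n) 1)"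
    "\<And>q. q \<in> A' \<Longrightarrow> g' q = f (x, q)"
    using extend_map_cell_complex_to_sphere[of "{?Q}" A' "cball (0::real^'n) 1" "\<lambda>q. f (x, q)"]
    by (metis Int_absorb bounded_cball convex_cball finite.emptyI finite.insertI singletonD)
  then have g': "continuous_on ?Q g'" "g' \<in> ?Q \<rightarrow> sphere (0::real^'n) 1"
    "\<And>q. q \<in> A' \<Longrightarrow> g' q = f (x, q)"
    by (simp_all add: rel_frontier_cball)
  let ?D = "{x} \<times> ?Q"
  define h where "h z = (if z \<in> A then f z else g' (snd z))" for z
  have cD: "closed ?D" using clQ by (intro closed_Times) auto
  have "continuous_on ?D (\<lambda>z. g' (snd z))"
    by (rule continuous_on_compose2[OF g'(1)]) (auto intro!: continuous_intros)
  moreover have "f z = g' (snd z)" if "z \<in> A" "z \<in> ?D" for z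
    using that g'(3)[of "snd z"] by (auto simp: A'_def)
  ultimately have ch: "continuous_on (A \<union> ?D) h"
    unfolding h_def using assms(1,2) cD by (intro continuous_on_glue_closed)
  moreover have "h \<in> A \<union> ?D \<rightarrow> sphere 0 1"
    using g'(2) assms(3) by (auto simp: h_def Pi_iff image_subset_iff)
  moreover have "closed (A \<union> ?D)" using assms(1) cD by (intro closed_Un)
  ultimately obtain V g where V: "A \<union> ?D \<subseteq> V" "open V" "continuous_on V g"
      "g \<in> V \<rightarrow> sphere 0 1" "\<And>z. z \<in> A \<union> ?D \<Longrightarrow> g z = h z"
    using neighbourhood_extension_into_ANR[OF _ _ ANR_sphere] by metis
  obtain X0 where X0: "open X0" "x \<in> X0" "X0 \<times> ?Q \<subseteq> V"
    using Elementary_Topology.tube_lemma[OF cQ V(2), of x] V(1) by (metis le_sup_iff)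
  obtain r where r: "r > 0" "cball x r \<subseteq> X0"
    using X0 open_contains_cball by metis
  have "A \<union> cball x r \<times> ?Q \<subseteq> V" using V(1) X0 r by blast
  then show ?thesis
    using r(1) V(3,4,5) by (intro exI[of _ r] exI[of _ g] conjI)
      (auto simp: h_def intro: continuous_on_subset)
qed

lemma homotopic_with_canon_on:
  assumes "continuous_on ({0..1::real} \<times> S) h" "h ` ({0..1} \<times> S) \<subseteq> T"
    "\<And>x. x \<in> S \<Longrightarrow> h (0, x) = f x" "\<And>x. x \<in> S \<Longrightarrow> h (1, x) = g x"
  shows "homotopic_with_canon (\<lambda>x. True) S T f g"
proof (subst homotopic_with)
  show "\<exists>h. continuous_map (prod_topology (top_of_set {0..1::real}) (top_of_set S)) (top_of_set T) h \<and>
      (\<forall>x\<in>topspace (top_of_set S). h (0, x) = f x) \<and>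
      (\<forall>x\<in>topspace (top_of_set S). h (1, x) = g x) \<and> (\<forall>t\<in>{0..1::real}. True)"
    using assms by (intro exI[of _ h]) (simp add: image_subset_iff_funcset)
qed simp

text \<open>
  The two extensions are homotopic over \<open>P1 \<inter> P2\<close>: the extra cube coordinate \<open>j\<close> serves as time, which
  the smaller dimension of \<open>P1 \<inter> P2\<close> pays for in the induction below.
\<close>

lemma sphere_extension_glue:
  fixes A :: "('a::euclidean_space \<times> (real^'n::finite)) set" and f :: "'a \<times> (real^'n) \<Rightarrow> real^'n"
  assumes A: "closed A" "continuous_on A f" "f ` A \<subseteq> sphere 0 1" and j: "j \<notin> J"
    and P: "compact P1" "compact P2"
    and g1: "continuous_on (A \<union> P1 \<times> coord_cube J) g1" "g1 ` (A \<union> P1 \<times> coord_cube J) \<subseteq> sphere 0 1"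
      "\<And>z. z \<in> A \<Longrightarrow> g1 z = f z"
    and g2: "continuous_on (A \<union> P2 \<times> coord_cube J) g2" "g2 ` (A \<union> P2 \<times> coord_cube J) \<subseteq> sphere 0 1"
      "\<And>z. z \<in> A \<Longrightarrow> g2 z = f z"
    and ext: "\<And>A f. closed A \<Longrightarrow> A \<subseteq> (P1 \<inter> P2) \<times> coord_cube (insert j J) \<Longrightarrow> continuous_on A f \<Longrightarrow>
      f ` A \<subseteq> sphere (0::real^'n) 1 \<Longrightarrow>
      \<exists>g. continuous_on ((P1 \<inter> P2) \<times> coord_cube (insert j J)) g \<and>
        g ` ((P1 \<inter> P2) \<times> coord_cube (insert j J)) \<subseteq> sphere 0 1 \<and> (\<forall>z\<in>A. g z = f z)"
  shows "\<exists>g. continuous_on (A \<union> (P1 \<union> P2) \<times> coord_cube J) g \<and>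
    g ` (A \<union> (P1 \<union> P2) \<times> coord_cube J) \<subseteq> sphere 0 1 \<and> (\<forall>z\<in>A. g z = f z)"
proof -
  let ?Q = "coord_cube J" and ?Q' = "coord_cube (insert j J)"
  let ?B = "P1 \<inter> P2"
  define \<pi> :: "'a \<times> (real^'n) \<Rightarrow> 'a \<times> (real^'n)" where "\<pi> z = (fst z, snd z - (snd z $ j) *\<^sub>R axis j 1)" for z
  have c\<pi>: "continuous_on S \<pi>" for S unfolding \<pi>_def by (intro continuous_intros)
  have clQ: "closed ?Q" "closed ?Q'" by (simp_all add: compact_coord_cube compact_imp_closed)
  have clP: "closed P1" "closed P2" using P by (simp_all add: compact_imp_closed)
  define D where "D = ?B \<times> ?Q'"
  have clD: "closed D" unfolding D_def using clQ clP by (intro closed_Times closed_Int)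
  have Qj: "q $ j = 0" if "q \<in> ?Q" for q using that j by (auto simp: in_coord_cube dest!: spec[of _ j])
  have \<pi>D: "\<pi> z \<in> ?B \<times> ?Q" if "z \<in> D" for z
    using that j by (auto simp: D_def \<pi>_def in_coord_cube axis_def)
  have addD: "(b, q + t *\<^sub>R axis j 1) \<in> D \<and> \<pi> (b, q + t *\<^sub>R axis j 1) = (b, q) \<and> (q + t *\<^sub>R axis j 1) $ j = t"
    if "b \<in> ?B" "q \<in> ?Q" "0 \<le> t" "t \<le> 1" for b q t
    using that Qj[OF that(2)] by (auto simp: D_def \<pi>_def in_coord_cube axis_def)
  \<comment> \<open>On the prism \<open>D\<close> the map \<open>h\<close> prescribes
    \<open>g1\<close> at the bottom \<open>S0\<close>, \<open>g2\<close> at the top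
    \<open>S1\<close> and \<open>f\<close> on the walls \<open>SA\<close> over \<open>A\<close>,
    each composed with the projection \<open>\<pi>\<close> along coordinate
    \<open>j\<close>.\<close>
  define S0 where "S0 = D \<inter> (\<lambda>z. snd z $ j) -` {0}"
  define S1 where "S1 = D \<inter> (\<lambda>z. snd z $ j) -` {1}"
  define SA where "SA = D \<inter> \<pi> -` A"
  have \<pi>S: "\<pi> ` S0 \<subseteq> ?B \<times> ?Q" "\<pi> ` S1 \<subseteq> ?B \<times> ?Q"
    unfolding S0_def S1_def by (rule image_subsetI, rule \<pi>D, blast)+
  have cl: "closed S0" "closed S1" "closed SA" unfolding S0_def S1_def SA_def
    using clD A(1) by (intro continuous_closed_preimage c\<pi> continuous_intros; simp)+
  define h1 where "h1 z = (if z \<in> S1 then g2 (\<pi> z) else f (\<pi> z))" for z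
  define h where "h z = (if z \<in> S0 then g1 (\<pi> z) else h1 z)" for z
  have "continuous_on (S1 \<union> SA) h1" unfolding h1_def
  proof (rule continuous_on_glue_closed)
    show "continuous_on S1 (\<lambda>z. g2 (\<pi> z))"
      by (rule continuous_on_compose2[OF g2(1) c\<pi>], rule subset_trans[OF \<pi>S(2)]) auto
    show "continuous_on SA (\<lambda>z. f (\<pi> z))"
      by (rule continuous_on_compose2[OF A(2) c\<pi>]) (auto simp: SA_def)
    show "g2 (\<pi> z) = f (\<pi> z)" if "z \<in> S1" "z \<in> SA" for z
      using that g2(3) by (auto simp: SA_def)
  qed (use cl in auto)
  then have ch: "continuous_on (S0 \<union> (S1 \<union> SA)) h" unfolding h_def
  proof (intro continuous_on_glue_closed)
    show "continuous_on S0 (\<lambda>z. g1 (\<pi> z))"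
      by (rule continuous_on_compose2[OF g1(1) c\<pi>], rule subset_trans[OF \<pi>S(1)]) auto
    show "g1 (\<pi> z) = h1 z" if "z \<in> S0" "z \<in> S1 \<union> SA" for z
      using that g1(3) by (auto simp: h1_def SA_def S0_def S1_def)
  qed (use cl in auto)
  have "h ` (S0 \<union> (S1 \<union> SA)) \<subseteq> sphere 0 1"
  proof
    fix y assume "y \<in> h ` (S0 \<union> (S1 \<union> SA))"
    then obtain z where z: "z \<in> S0 \<union> (S1 \<union> SA)" "y = h z" by blast
    show "y \<in> sphere 0 1"
    proof (cases "z \<in> S0")
      case True
      then have "\<pi> z \<in> A \<union> P1 \<times> ?Q" using \<pi>D[of z] by (auto simp: S0_def)
      then show ?thesis using g1(2) True z(2) by (auto simp: h_def image_subset_iff)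
    next
      case F0: False
      show ?thesis
      proof (cases "z \<in> S1")
        case True
        then have "\<pi> z \<in> A \<union> P2 \<times> ?Q" using \<pi>D[of z] by (auto simp: S1_def)
        then show ?thesis using g2(2) True F0 z(2) by (auto simp: h_def h1_def image_subset_iff)
      next
        case False
        then have "\<pi> z \<in> A" using F0 z(1) by (auto simp: SA_def)
        then show ?thesis using A(3) False F0 z(2) by (auto simp: h_def h1_def image_subset_iff)
      qed
    qed
  qed
  moreover have "S0 \<union> (S1 \<union> SA) \<subseteq> D" "closed (S0 \<union> (S1 \<union> SA))"
    using cl by (auto simp: S0_def S1_def SA_def)
  ultimately have "\<exists>G. continuous_on D G \<and> G ` D \<subseteq> sphere 0 1 \<and> (\<forall>z\<in>S0 \<union> (S1 \<union> SA). G z = h z)"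
    using ch unfolding D_def by (intro ext)
  then obtain G where G: "continuous_on D G" "G ` D \<subseteq> sphere 0 1" "\<And>z. z \<in> S0 \<union> (S1 \<union> SA) \<Longrightarrow> G z = h z"
    by blast
  let ?Z = "A \<union> ?B \<times> ?Q"
  \<comment> \<open>The homotopy reads coordinate \<open>j\<close> of \<open>G\<close> as time and
    is constant in time on \<open>A\<close>, where both maps agree with \<open>f\<close>.\<close>
  define k where "k p = (if p \<in> {0..1::real} \<times> A then f (snd p) else G (fst (snd p), snd (snd p) + fst p *\<^sub>R axis j 1))" for p
  have clB: "closed (?B \<times> ?Q)" using clQ clP by (intro closed_Times closed_Int)
  have Gf: "G (b, q + t *\<^sub>R axis j 1) = f (b, q)" if "(b, q) \<in> A" "b \<in> ?B" "q \<in> ?Q" "0 \<le> t" "t \<le> 1" for b q t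
  proof -
    let ?z = "(b, q + t *\<^sub>R axis j 1)"
    have "?z \<in> SA" "\<pi> ?z = (b, q)" using addD[OF that(2-5)] that(1) by (auto simp: SA_def)
    then have "h ?z = f (b, q)" using g1(3)[OF that(1)] g2(3)[OF that(1)] by (simp add: h_def h1_def)
    then show ?thesis using G(3)[of ?z] \<open>?z \<in> SA\<close> by simp
  qed
  have kc: "continuous_on (({0..1} \<times> A) \<union> ({0..1} \<times> (?B \<times> ?Q))) k"
    unfolding k_def
  proof (rule continuous_on_glue_closed)
    show "closed ({0..1::real} \<times> A)" "closed ({0..1::real} \<times> (?B \<times> ?Q))"
      using A(1) clB by (auto intro!: closed_Times)
    show "continuous_on ({0..1::real} \<times> A) (\<lambda>x. f (snd x))"
      by (rule continuous_on_compose2[OF A(2)]) (auto intro!: continuous_intros)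
    show "continuous_on ({0..1} \<times> (?B \<times> ?Q)) (\<lambda>x. G (fst (snd x), snd (snd x) + fst x *\<^sub>R axis j 1))"
      by (rule continuous_on_compose2[OF G(1)]) (intro continuous_intros, use addD in auto)
  qed (use Gf in auto)
  have "homotopic_with_canon (\<lambda>x. True) ?Z (sphere 0 1) g1 g2"
  proof (rule homotopic_with_canon_on[where h = k])
    show "continuous_on ({0..1} \<times> ?Z) k" using kc by (simp add: Sigma_Un_distrib2)
    show "k ` ({0..1} \<times> ?Z) \<subseteq> sphere 0 1"
      using A(3) G(2) addD by (auto simp: k_def image_subset_iff)
    fix z assume z: "z \<in> ?Z"
    have h0: "k (0, z) = g1 z \<and> k (1, z) = g2 z" if zA: "z \<notin> A"
    proof -
      obtain b q where bq: "z = (b, q)" "b \<in> ?B" "q \<in> ?Q" using z zA by auto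
      let ?z0 = "(b, q + 0 *\<^sub>R axis j 1)" and ?z1 = "(b, q + 1 *\<^sub>R axis j 1)"
      have z0: "?z0 \<in> S0" "\<pi> ?z0 = z" using addD[OF bq(2,3), of 0] bq(1) by (auto simp: S0_def)
      have z1: "?z1 \<in> S1" "?z1 \<notin> S0" "\<pi> ?z1 = z" using addD[OF bq(2,3), of 1] bq(1) by (auto simp: S0_def S1_def)
      have "G ?z0 = g1 z" "G ?z1 = g2 z"
        using G(3)[of ?z0] G(3)[of ?z1] z0 z1 by (simp_all add: h_def h1_def)
      then show ?thesis using zA bq(1) by (simp add: k_def)
    qed
    show "k (0, z) = g1 z" using h0 g1(3) by (cases "z \<in> A") (auto simp: k_def)
    show "k (1, z) = g2 z" using h0 g2(3) by (cases "z \<in> A") (auto simp: k_def)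
  qed
  moreover have "closed ?Z" "closed (A \<union> P1 \<times> ?Q)" "closed (A \<union> P2 \<times> ?Q)"
    using A(1) clB clP clQ by (auto intro!: closed_Un closed_Times)
  moreover have "?Z \<subseteq> A \<union> P1 \<times> ?Q" by blast
  moreover have "g1 \<in> A \<union> P1 \<times> ?Q \<rightarrow> sphere 0 1" using g1(2) by blast
  \<comment> \<open>By Borsuk's homotopy extension theorem \<open>g1\<close> can be replaced by a
    map that equals \<open>g2\<close> on the overlap \<open>?Z\<close>, and then the two maps can be
    glued.\<close>
  ultimately obtain g1' where g1': "continuous_on (A \<union> P1 \<times> ?Q) g1'" "g1' ` (A \<union> P1 \<times> ?Q) \<subseteq> sphere 0 1"
      "\<And>z. z \<in> ?Z \<Longrightarrow> g1' z = g2 z"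
    using Borsuk_homotopy_extension_homotopic[of "A \<union> P1 \<times> ?Q" ?Z "sphere (0::real^'n) 1" g1 g2] g1(1)
    by (metis ANR_sphere closed_subset)
  define g where "g z = (if z \<in> A \<union> P1 \<times> ?Q then g1' z else g2 z)" for z
  have "continuous_on ((A \<union> P1 \<times> ?Q) \<union> (A \<union> P2 \<times> ?Q)) g" unfolding g_def
    by (rule continuous_on_glue_closed)
      (use g1' g2 \<open>closed (A \<union> P1 \<times> ?Q)\<close> \<open>closed (A \<union> P2 \<times> ?Q)\<close> in auto)
  moreover have "(A \<union> P1 \<times> ?Q) \<union> (A \<union> P2 \<times> ?Q) = A \<union> (P1 \<union> P2) \<times> ?Q" by blast
  moreover have "g ` (A \<union> (P1 \<union> P2) \<times> ?Q) \<subseteq> sphere 0 1"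
    using g1'(2) g2(2) by (auto simp: g_def image_subset_iff)
  moreover have "\<forall>z\<in>A. g z = f z" using g1'(3) g2(3) by (auto simp: g_def)
  ultimately show ?thesis by metis
qed

text \<open>\<open>X\<close> is covered by finitely many small open sets over whose closures the
  extension exists and whose frontiers have lower dimension; these are added one at a time. Passing
  to a frontier lowers \<open>d\<close> by one and gluing adds one cube coordinate, so
  \<open>d + card J\<close> is preserved.\<close>

lemma sphere_extension_dim_le:
  fixes X :: "'a::euclidean_space set" and A :: "('a \<times> (real^'n::finite)) set" and f :: "'a \<times> (real^'n) \<Rightarrow> real^'n"
  assumes "compact X" "top_of_set X dim_le (int d - 1)" "d + card J \<le> CARD('n)"
    "closed A" "A \<subseteq> X \<times> coord_cube J" "continuous_on A f" "f ` A \<subseteq> sphere 0 1"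
  shows "\<exists>g. continuous_on (X \<times> coord_cube J) g \<and> g ` (X \<times> coord_cube J) \<subseteq> sphere 0 1 \<and> (\<forall>z\<in>A. g z = f z)"
  using assms
proof (induction d arbitrary: X J A f)
  case 0
  then have "topspace (top_of_set X) = {}" by (simp del: topspace_euclidean_subtopology)
  then have "X = {}" by simp
  then show ?case using 0 by auto
next
  case (Suc d)
  note cX = Suc.prems(1) and A = Suc.prems(4,6,7) and AX = Suc.prems(5)
  have dX: "top_of_set X dim_le int d" using Suc.prems(2) by simp
  have "J \<noteq> UNIV" using Suc.prems(3) by auto
  then obtain j where j: "j \<notin> J" by blast
  let ?Q = "coord_cube J"
  define E where "E P \<longleftrightarrow> (\<exists>g. continuous_on (A \<union> P \<times> ?Q) g \<and> g ` (A \<union> P \<times> ?Q) \<subseteq> sphere 0 1 \<and> (\<forall>z\<in>A. g z = f z))" for P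
  have mono: "E P'" if EP: "E P" and sub: "P' \<subseteq> P" for P P'
  proof -
    obtain g where g: "continuous_on (A \<union> P \<times> ?Q) g" "g ` (A \<union> P \<times> ?Q) \<subseteq> sphere 0 1" "\<forall>z\<in>A. g z = f z"
      using EP unfolding E_def by blast
    have "A \<union> P' \<times> ?Q \<subseteq> A \<union> P \<times> ?Q" using sub by blast
    then show ?thesis using g unfolding E_def
      by (intro exI[of _ g]) (meson continuous_on_subset image_mono order_trans)
  qed
  have loc: "\<exists>U. openin (top_of_set X) U \<and> x \<in> U \<and> E (X \<inter> closure U) \<and>
      top_of_set (top_of_set X frontier_of U) dim_le int d - 1" if x: "x \<in> X" for x
  proof -
    obtain r where r: "r > 0" "E (cball x r)"
      using sphere_extension_to_point[OF A j, of x] unfolding E_def by blast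
    have "openin (top_of_set X) (X \<inter> ball x r)" "x \<in> X \<inter> ball x r"
      using x r(1) by (auto intro: openin_open_Int)
    then obtain U where U: "x \<in> U" "U \<subseteq> X \<inter> ball x r" "openin (top_of_set X) U"
        "subtopology (top_of_set X) (top_of_set X frontier_of U) dim_le int d - 1"
      using dX unfolding dimension_le.simps[of "top_of_set X" "int d"] by blast
    have "closure U \<subseteq> cball x r"
      using U(2) ball_subset_cball by (intro closure_minimal) auto
    then have "E (X \<inter> closure U)" using r(2) by (intro mono[OF r(2)]) blast
    moreover have "X \<inter> top_of_set X frontier_of U = top_of_set X frontier_of U"
      using frontier_of_subset_topspace[of "top_of_set X" U] by auto
    ultimately show ?thesis using U by (auto simp: subtopology_subtopology)
  qed
  then obtain U where U: "\<And>x. x \<in> X \<Longrightarrow> openin (top_of_set X) (U x)" "\<And>x. x \<in> X \<Longrightarrow> x \<in> U x"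
    "\<And>x. x \<in> X \<Longrightarrow> E (X \<inter> closure (U x))"
    "\<And>x. x \<in> X \<Longrightarrow> top_of_set (top_of_set X frontier_of (U x)) dim_le int d - 1"
    by metis
  have "\<forall>x\<in>X. \<exists>W. open W \<and> U x = X \<inter> W" using U(1) unfolding openin_open by blast
  then obtain W where W: "\<And>x. x \<in> X \<Longrightarrow> open (W x)" "\<And>x. x \<in> X \<Longrightarrow> U x = X \<inter> W x" by metis
  have "X \<subseteq> (\<Union>x\<in>X. W x)" using U(2) W(2) by blast
  then obtain F where F: "F \<subseteq> X" "finite F" "X \<subseteq> (\<Union>x\<in>F. W x)"
    using compactE_image[OF cX, of X W] W(1) by metis
  have "E (\<Union>x\<in>F'. X \<inter> closure (U x))" if "finite F'" "F' \<subseteq> F" for F'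
    using that
  proof (induction F')
    case empty
    then show ?case using A(2,3) unfolding E_def by (intro exI[of _ f]) auto
  next
    case (insert x F')
    have x: "x \<in> X" using insert.prems F(1) by blast
    let ?P = "\<Union>x\<in>F'. X \<inter> closure (U x)"
    \<comment> \<open>Nothing is lost by removing the open set \<open>W x\<close>, because
      \<open>P2\<close> contains \<open>X \<inter> W x\<close>. What remains meets \<open>P2\<close>
      only in the frontier of \<open>U x\<close>, where the induction hypothesis applies.\<close>
    define P1 where "P1 = ?P - W x"
    define P2 where "P2 = X \<inter> closure (U x)"
    have cP: "compact P1" "compact P2" unfolding P1_def P2_def
      using cX insert.hyps(1) W(1)[OF x] by (auto intro!: compact_diff compact_UN compact_Int_closed)
    have "E P1" using insert.IH insert.prems mono unfolding P1_def by blast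
    then obtain g1 where g1: "continuous_on (A \<union> P1 \<times> ?Q) g1" "g1 ` (A \<union> P1 \<times> ?Q) \<subseteq> sphere 0 1"
      "\<And>z. z \<in> A \<Longrightarrow> g1 z = f z" unfolding E_def by blast
    have "E P2" using U(3)[OF x] by (simp add: P2_def)
    then obtain g2 where g2: "continuous_on (A \<union> P2 \<times> ?Q) g2" "g2 ` (A \<union> P2 \<times> ?Q) \<subseteq> sphere 0 1"
      "\<And>z. z \<in> A \<Longrightarrow> g2 z = f z" unfolding E_def by blast
    have "P1 \<inter> P2 \<subseteq> top_of_set X frontier_of (U x)"
      using W(2)[OF x] U(1)[OF x]
      by (auto simp: P1_def P2_def frontier_of_def interior_of_openin closure_of_subtopology)
    then have dB: "top_of_set (P1 \<inter> P2) dim_le int d - 1"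
      using dimension_le_subtopologies[OF U(4)[OF x]] by blast
    have "E (P1 \<union> P2)" unfolding E_def
    proof (rule sphere_extension_glue[OF A j cP g1 g2])
      fix A' and f' :: "'a \<times> (real^'n) \<Rightarrow> real^'n"
      assume "closed A'" "A' \<subseteq> (P1 \<inter> P2) \<times> coord_cube (insert j J)" "continuous_on A' f'" "f' ` A' \<subseteq> sphere 0 1"
      moreover have "compact (P1 \<inter> P2)" using cP by (intro compact_Int)
      moreover have "d + card (insert j J) \<le> CARD('n)" using Suc.prems(3) j by simp
      ultimately show "\<exists>g. continuous_on ((P1 \<inter> P2) \<times> coord_cube (insert j J)) g \<and>
          g ` ((P1 \<inter> P2) \<times> coord_cube (insert j J)) \<subseteq> sphere 0 1 \<and> (\<forall>z\<in>A'. g z = f' z)"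
        using dB by (intro Suc.IH)
    qed
    moreover have "P1 \<union> P2 = (\<Union>x\<in>insert x F'. X \<inter> closure (U x))"
      using W(2)[OF x] closure_subset[of "U x"] by (auto simp: P1_def P2_def)
    ultimately show ?case by simp
  qed
  from this[OF F(2)] have "E (\<Union>x\<in>F. X \<inter> closure (U x))" by simp
  moreover have "X \<subseteq> (\<Union>x\<in>F. X \<inter> closure (U x))"
  proof
    fix y assume y: "y \<in> X"
    then obtain x where x: "x \<in> F" "y \<in> W x" using F(3) by blast
    then have "y \<in> U x" using W(2)[of x] F(1) y by blast
    then show "y \<in> (\<Union>x\<in>F. X \<inter> closure (U x))" using y x(1) closure_subset by blast
  qed
  ultimately have "E X" by (rule mono)
  moreover have "A \<union> X \<times> ?Q = X \<times> ?Q" using AX by blast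
  ultimately show ?case unfolding E_def by simp
qed

text \<open>A null-homotopy comes from extending, over \<open>X\<close> times a segment, the map
  that is \<open>f\<close> at one end and constant at the other. With \<open>d = n - 1\<close> and
  one cube coordinate, the bound \<open>d + card J \<le> n\<close> is just met.\<close>

lemma nullhomotopic_into_sphere_dim_le:
  fixes X :: "'a::euclidean_space set" and f :: "'a \<Rightarrow> real^'n::finite"
  assumes X: "compact X" "top_of_set X dim_le (int CARD('n) - 2)"
    and f: "continuous_on X f" "f ` X \<subseteq> sphere 0 1"
  shows "\<exists>c. homotopic_with_canon (\<lambda>x. True) X (sphere 0 1) f (\<lambda>x. c)"
proof -
  obtain j :: 'n where True by simp
  define e where "e = (axis j 1 :: real^'n)"
  define A where "A = X \<times> {0, e}"
  have cl: "closed X" using X(1) by (rule compact_imp_closed)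
  have eQ: "0 \<in> coord_cube {j}" "e \<in> coord_cube {j}" "e \<noteq> 0" "norm e = 1"
    by (auto simp: e_def in_coord_cube axis_eq_0_iff norm_axis_1) (auto simp: axis_def)
  have tQ: "t *\<^sub>R e \<in> coord_cube {j}" if "0 \<le> t" "t \<le> 1" for t
    using that by (auto simp: e_def in_coord_cube axis_def)
  define h where "h z = (if z \<in> X \<times> {0} then f (fst z) else e)" for z :: "'a \<times> (real^'n)"
  have "continuous_on (X \<times> {0} \<union> X \<times> {e}) h" unfolding h_def
  proof (rule continuous_on_glue_closed)
    show "continuous_on (X \<times> {0}) (\<lambda>x. f (fst x))"
      by (rule continuous_on_compose2[OF f(1)]) (auto intro!: continuous_intros)
  qed (use cl eQ in \<open>auto intro!: closed_Times\<close>)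
  moreover have "X \<times> {0} \<union> X \<times> {e} = A" unfolding A_def by blast
  moreover have "h ` A \<subseteq> sphere 0 1" using f(2) eQ by (auto simp: h_def image_subset_iff)
  moreover have "closed A" unfolding A_def using cl by (intro closed_Times) auto
  moreover have "A \<subseteq> X \<times> coord_cube {j}" using eQ by (auto simp: A_def)
  moreover have "top_of_set X dim_le (int (CARD('n) - 1) - 1)"
    using X(2) by (simp add: of_nat_diff Suc_leI)
  moreover have "CARD('n) - 1 + card {j} \<le> CARD('n)" by simp
  ultimately obtain g where g: "continuous_on (X \<times> coord_cube {j}) g" "g ` (X \<times> coord_cube {j}) \<subseteq> sphere 0 1"
      "\<And>z. z \<in> A \<Longrightarrow> g z = h z"
    using sphere_extension_dim_le[OF X(1), of "CARD('n) - 1" "{j}" A h] by metis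
  have "homotopic_with_canon (\<lambda>x. True) X (sphere 0 1) f (\<lambda>x. e)"
  proof (rule homotopic_with_canon_on[where h = "\<lambda>p. g (snd p, fst p *\<^sub>R e)"])
    show "continuous_on ({0..1::real} \<times> X) (\<lambda>p. g (snd p, fst p *\<^sub>R e))"
      by (rule continuous_on_compose2[OF g(1)]) (intro continuous_intros, use tQ in auto)
    show "(\<lambda>p. g (snd p, fst p *\<^sub>R e)) ` ({0..1} \<times> X) \<subseteq> sphere 0 1"
      using g(2) tQ by (auto simp: image_subset_iff)
    show "g (snd (0::real, x), fst (0::real, x) *\<^sub>R e) = f x" if "x \<in> X" for x
      using g(3)[of "(x, 0)"] that by (simp add: A_def h_def)
    show "g (snd (1::real, x), fst (1::real, x) *\<^sub>R e) = e" if "x \<in> X" for x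
      using g(3)[of "(x, e)"] that eQ by (simp add: A_def h_def)
  qed
  then show ?thesis by blast
qed

text \<open>The component of \<open>a\<close> in the complement of the frontier cannot leave
  \<open>C\<close> without meeting the frontier, so it is bounded. Borsuk's criterion then makes the
  radial projection from \<open>a\<close> essential on the frontier.\<close>

lemma not_dimension_le_frontier:
  fixes C :: "(real^'n::finite) set"
  assumes "compact C" "interior C \<noteq> {}"
  shows "\<not> top_of_set (frontier C) dim_le (int CARD('n) - 2)"
proof
  assume d: "top_of_set (frontier C) dim_le (int CARD('n) - 2)"
  obtain a where a: "a \<in> interior C" using assms(2) by blast
  let ?S = "frontier C"
  have S: "compact ?S" "a \<notin> ?S" using compact_frontier[OF assms(1)] a by (auto simp: frontier_def)
  have "connected_component_set (- ?S) a \<subseteq> C"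
  proof (rule ccontr)
    assume "\<not> ?thesis"
    moreover have "a \<in> connected_component_set (- ?S) a" using S(2) by simp
    moreover have "a \<in> C" using a interior_subset by blast
    ultimately have "connected_component_set (- ?S) a \<inter> C \<noteq> {}" "connected_component_set (- ?S) a - C \<noteq> {}"
      by blast+
    then have "connected_component_set (- ?S) a \<inter> ?S \<noteq> {}"
      by (intro connected_Int_frontier connected_connected_component)
    then show False using connected_component_subset[of "- ?S" a] by blast
  qed
  then have "bounded (connected_component_set (- ?S) a)"
    using assms(1) compact_imp_bounded bounded_subset by blast
  moreover have "continuous_on ?S (\<lambda>x. inverse (norm (x - a)) *\<^sub>R (x - a))"
    using S(2) by (intro continuous_intros) auto
  moreover have "(\<lambda>x. inverse (norm (x - a)) *\<^sub>R (x - a)) ` ?S \<subseteq> sphere 0 1"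
    using Borsuk_map_into_sphere[of a ?S] S(2) by blast
  ultimately show False
    using nullhomotopic_into_sphere_dim_le[OF S(1) d] Borsuk_map_essential_bounded_component[OF S]
    by blast
qed

lemma small_ind_dim_eqI:
  assumes "X dim_le d" "\<not> X dim_le (d - 1)"
  shows "small_ind_dim X = ereal (of_int d)"
  unfolding small_ind_dim_def
proof (rule antisym)
  show "(INF k\<in>{k. X dim_le k}. ereal (of_int k)) \<le> ereal (of_int d)"
    using assms(1) by (intro INF_lower) simp
  show "ereal (of_int d) \<le> (INF k\<in>{k. X dim_le k}. ereal (of_int k))"
  proof (rule INF_greatest)
    fix k assume k: "k \<in> {k. X dim_le k}"
    have "d \<le> k"
    proof (rule ccontr)
      assume "\<not> d \<le> k"
      moreover have "X dim_le k" using k by simp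
      ultimately have "X dim_le (d - 1)" using dimension_le_mono[of X k "d - 1"] by simp
      then show False using assms(2) by simp
    qed
    then show "ereal (of_int d) \<le> ereal (of_int k)" by simp
  qed
qed

lemma dim_T_frontier:
  fixes C :: "(real^'n::finite) set"
  assumes "compact C" "interior C \<noteq> {}"
  shows "dim_T (frontier C) = ereal (real CARD('n) - 1)"
proof -
  have "frontier C \<subseteq> C" using assms(1) by (intro frontier_subset_closed compact_imp_closed)
  then have "interior (frontier C) \<subseteq> interior C" by (rule interior_mono)
  moreover have "interior (frontier C) \<subseteq> frontier C" by (rule interior_subset)
  ultimately have "interior (frontier C) = {}" by (auto simp: frontier_def)
  then have "top_of_set (frontier C) dim_le (int CARD('n) - 1)"
    by (intro dimension_le_nowhere_dense) auto
  moreover have "\<not> top_of_set (frontier C) dim_le (int CARD('n) - 1 - 1)"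
    using not_dimension_le_frontier[OF assms] by simp
  ultimately have "dim_T (frontier C) = ereal (of_int (int CARD('n) - 1))" by (rule small_ind_dim_eqI)
  then show ?thesis by simp
qed

section \<open>Hausdorff measures\<close>

lemma hausdorff_premeasure_mono:
  fixes S :: "'a::metric_space set"
  assumes "S \<subseteq> T"
  shows "hausdorff_premeasure h \<delta> S \<le> hausdorff_premeasure h \<delta> T"
  unfolding hausdorff_premeasure_def
proof (rule Inf_superset_mono, rule subsetI)
  fix b assume "b \<in> {(\<Sum>i. if A i = {} then 0 else ennreal (h (diameter (A i)))) | A :: nat \<Rightarrow> 'a set.
      T \<subseteq> (\<Union>i. A i) \<and> (\<forall>i. bounded (A i) \<and> diameter (A i) \<le> \<delta>)}"
  then obtain A :: "nat \<Rightarrow> 'a set" where A: "b = (\<Sum>i. if A i = {} then 0 else ennreal (h (diameter (A i))))"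
    "T \<subseteq> (\<Union>i. A i)" "\<forall>i. bounded (A i) \<and> diameter (A i) \<le> \<delta>" by blast
  have "S \<subseteq> (\<Union>i. A i)" using assms A(2) by (rule order_trans)
  then show "b \<in> {(\<Sum>i. if A i = {} then 0 else ennreal (h (diameter (A i)))) | A :: nat \<Rightarrow> 'a set.
      S \<subseteq> (\<Union>i. A i) \<and> (\<forall>i. bounded (A i) \<and> diameter (A i) \<le> \<delta>)}"
    using A(1,3) by blast
qed

lemma power_gauge_eq_power:
  "0 \<le> x \<Longrightarrow> power_gauge (real m) x = x ^ m"
  by (cases "x = 0") (auto simp: power_gauge_def powr_realpow)

lemma power_gauge_antimono:
  assumes "0 \<le> s" "s \<le> t" "0 \<le> x" "x \<le> 1"
  shows "power_gauge t x \<le> power_gauge s x"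
proof (cases "x = 0")
  case True
  then show ?thesis using assms by (simp add: power_gauge_def)
next
  case False
  then show ?thesis using assms powr_mono'[of s t x] powr_le1[of t x] by (auto simp: power_gauge_def)
qed

lemma gauge_function_power_gauge:
  assumes "0 \<le> s"
  shows "gauge_function (power_gauge s)"
proof -
  have "power_gauge s x \<le> power_gauge s y" if "0 \<le> x" "x \<le> y" for x y
    using assms that powr_mono2[of s x y] by (simp add: power_gauge_def)
  moreover have "0 \<le> power_gauge s x" for x by (simp add: power_gauge_def)
  ultimately show ?thesis unfolding gauge_function_def by (auto intro!: mono_onI)
qed

text \<open>With \<open>m = n - 1\<close>, places all powers above n - 1 among the gauges of the
  measure-zero statement.\<close>

lemma power_gauge_quotient_tendsto_0:
  assumes "e > 0"
  shows "((\<lambda>r. power_gauge (real m + e) r / r ^ m) \<longlongrightarrow> 0) (at_right 0)"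
proof -
  have "((\<lambda>r::real. r powr e) \<longlongrightarrow> 0 powr e) (at_right 0)"
    using assms by (intro tendsto_intros) (auto simp: eventually_at_right_less intro: eventually_mono[OF eventually_at_right_less])
  then have lim: "((\<lambda>r::real. r powr e) \<longlongrightarrow> 0) (at_right 0)" by simp
  have "\<forall>\<^sub>F r in at_right 0. r powr e = power_gauge (real m + e) r / r ^ m"
    using eventually_at_right_less[of "0::real"]
  proof eventually_elim
    case (elim r)
    then show ?case using assms by (simp add: power_gauge_def powr_add powr_realpow)
  qed
  from Lim_transform_eventually[OF lim this] show ?thesis .
qed

lemma hausdorff_premeasure_mono_gauge:
  assumes "\<And>x. 0 \<le> x \<Longrightarrow> x \<le> \<delta> \<Longrightarrow> h x \<le> h' x"
  shows "hausdorff_premeasure h \<delta> S \<le> hausdorff_premeasure h' \<delta> S"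
  unfolding hausdorff_premeasure_def
proof (rule Inf_mono)
  fix b assume "b \<in> {(\<Sum>i. if A i = {} then 0 else ennreal (h' (diameter (A i)))) | A :: nat \<Rightarrow> 'a set.
      S \<subseteq> (\<Union>i. A i) \<and> (\<forall>i. bounded (A i) \<and> diameter (A i) \<le> \<delta>)}"
  then obtain A :: "nat \<Rightarrow> 'a set" where A: "b = (\<Sum>i. if A i = {} then 0 else ennreal (h' (diameter (A i))))"
    "S \<subseteq> (\<Union>i. A i)" "\<And>i. bounded (A i) \<and> diameter (A i) \<le> \<delta>" by blast
  have "(\<Sum>i. if A i = {} then 0 else ennreal (h (diameter (A i)))) \<le> b"
    unfolding A(1) using A(3) assms diameter_ge_0
    by (intro suminf_le summableI) (auto intro!: ennreal_leI)
  then show "\<exists>a\<in>{(\<Sum>i. if A i = {} then 0 else ennreal (h (diameter (A i)))) | A :: nat \<Rightarrow> 'a set.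
      S \<subseteq> (\<Union>i. A i) \<and> (\<forall>i. bounded (A i) \<and> diameter (A i) \<le> \<delta>)}. a \<le> b"
    using A(2,3) by blast
qed

lemma hausdorff_measure_mono_gauge:
  assumes "\<And>x. 0 \<le> x \<Longrightarrow> x \<le> 1 \<Longrightarrow> h x \<le> h' x"
  shows "hausdorff_measure h S \<le> hausdorff_measure h' S"
  unfolding hausdorff_measure_eq_SUP
proof (rule SUP_mono)
  fix \<delta> :: real assume "\<delta> \<in> {0<..}"
  then have "min \<delta> 1 \<in> {0<..}" by simp
  moreover have "hausdorff_premeasure h \<delta> S \<le> hausdorff_premeasure h (min \<delta> 1) S"
    by (rule hausdorff_premeasure_antimono) simp
  moreover have "hausdorff_premeasure h (min \<delta> 1) S \<le> hausdorff_premeasure h' (min \<delta> 1) S"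
    using assms by (intro hausdorff_premeasure_mono_gauge) auto
  ultimately show "\<exists>\<delta>'\<in>{0<..}. hausdorff_premeasure h \<delta> S \<le> hausdorff_premeasure h' \<delta>' S"
    by (meson order_trans)
qed

lemma hausdorff_premeasure_le_finite_cover:
  assumes I: "finite I" and S: "S \<subseteq> (\<Union>i\<in>I. B i)"
    and B: "\<And>i. i \<in> I \<Longrightarrow> bounded (B i) \<and> diameter (B i) \<le> d" and d: "0 \<le> d" "d \<le> \<delta>"
    and h: "gauge_function h"
  shows "hausdorff_premeasure h \<delta> S \<le> ennreal (real (card I) * h d)"
proof -
  obtain b where b: "bij_betw b {..<card I} I"
    using ex_bij_betw_nat_finite[OF I] by (auto simp: atLeast0LessThan)
  \<comment> \<open>The cover is padded with empty sets, which contribute 0 even if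
    \<open>h 0 > 0\<close>.\<close>
  define A where "A k = (if k < card I then B (b k) else {})" for k
  have bI: "b k \<in> I" if "k < card I" for k using b that by (auto simp: bij_betw_def)
  have hd: "0 \<le> h d" using h d by (simp add: gauge_function_def)
  have A: "bounded (A k) \<and> diameter (A k) \<le> d" for k
    using B[OF bI[of k]] d by (simp add: A_def)
  have "S \<subseteq> (\<Union>k. A k)"
  proof
    fix x assume "x \<in> S"
    then obtain i where i: "i \<in> I" "x \<in> B i" using S by blast
    then obtain k where "k < card I" "i = b k" using b unfolding bij_betw_def by (metis imageE lessThan_iff)
    then have "x \<in> A k" using i by (simp add: A_def)
    then show "x \<in> (\<Union>k. A k)" by blast
  qed
  moreover have "bounded (A k) \<and> diameter (A k) \<le> \<delta>" for k
    using A[of k] d(2) by simp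
  ultimately have "hausdorff_premeasure h \<delta> S \<le> (\<Sum>k. if A k = {} then 0 else ennreal (h (diameter (A k))))"
    unfolding hausdorff_premeasure_def by (intro Inf_lower CollectI exI[of _ A]) simp
  also have "\<dots> = (\<Sum>k<card I. if A k = {} then 0 else ennreal (h (diameter (A k))))"
    by (rule suminf_finite) (auto simp: A_def)
  also have "\<dots> \<le> (\<Sum>k<card I. ennreal (h d))"
  proof (rule sum_mono)
    fix k assume "k \<in> {..<card I}"
    have "h (diameter (A k)) \<le> h d"
      using h A[of k] diameter_ge_0[of "A k"] d unfolding gauge_function_def by (auto intro: mono_onD)
    then show "(if A k = {} then 0 else ennreal (h (diameter (A k)))) \<le> ennreal (h d)"
      by (simp add: ennreal_leI)
  qed
  also have "\<dots> = ennreal (real (card I) * h d)"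
    using hd by (simp add: ennreal_mult ennreal_of_nat_eq_real_of_nat)
  finally show ?thesis .
qed

section \<open>Positive measure of the boundary, by projection\<close>

lemma emeasure_cbox_slab:
  fixes p :: "real^'n::finite"
  assumes "0 \<le> d" "0 \<le> r"
  shows "emeasure lborel (cbox (\<chi> i. if i = j then a - r else p $ i - d) (\<chi> i. if i = j then a + r else p $ i + d))
    = ennreal ((2 * d) ^ (CARD('n) - 1) * (2 * r))"
proof -
  let ?l = "\<chi> i. if i = j then a - r else p $ i - d" and ?u = "\<chi> i. if i = j then a + r else p $ i + d"
  have "?l \<in> cbox ?l ?u" using assms by (simp add: mem_box_cart)
  then have "cbox ?l ?u \<noteq> {}" by blast
  then have "measure lborel (cbox ?l ?u) = (\<Prod>i\<in>UNIV. ?u $ i - ?l $ i)"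
    by (rule content_cbox_cart)
  also have "\<dots> = (\<Prod>i\<in>UNIV. if i = j then 2 * r else 2 * d)"
    by (intro prod.cong) auto
  also have "\<dots> = (2 * d) ^ (CARD('n) - 1) * (2 * r)"
    by (subst prod.remove[of _ j]) (auto simp: card_Diff_singleton mult.commute intro!: prod.cong)
  finally have "measure lborel (cbox ?l ?u) = (2 * d) ^ (CARD('n) - 1) * (2 * r)" .
  then show ?thesis
    using emeasure_lborel_cbox_finite[of ?l ?u] by (simp add: emeasure_eq_ennreal_measure)
qed

lemma ray_meets_frontier:
  fixes C :: "'a::real_normed_vector set"
  assumes "bounded C" "x \<in> C" "e \<noteq> 0"
  shows "\<exists>t\<ge>0. x + t *\<^sub>R e \<in> frontier C"
proof -
  let ?R = "(\<lambda>t. x + t *\<^sub>R e) ` {0..}"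
  obtain B where B: "\<And>y. y \<in> C \<Longrightarrow> norm (y - x) < B"
  proof -
    obtain B0 where B0: "\<And>y. y \<in> C \<Longrightarrow> norm y \<le> B0" using assms(1) unfolding bounded_iff by blast
    have "norm (y - x) < B0 + norm x + 1" if "y \<in> C" for y
      using norm_triangle_ineq4[of y x] B0[OF that] by linarith
    then show thesis by (rule that)
  qed
  have "B > 0" using B[OF assms(2)] by simp
  \<comment> \<open>At time \<open>B / norm e\<close> the ray has travelled the distance
    \<open>B\<close> and is outside \<open>C\<close>.\<close>
  have "x + (B / norm e) *\<^sub>R e \<notin> C"
    using B[of "x + (B / norm e) *\<^sub>R e"] assms(3) \<open>B > 0\<close> by auto
  moreover have "x + (B / norm e) *\<^sub>R e \<in> ?R" using \<open>B > 0\<close> by (intro imageI) simp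
  ultimately have "?R - C \<noteq> {}" by blast
  moreover have "x + 0 *\<^sub>R e \<in> ?R" by (intro imageI) simp
  then have "?R \<inter> C \<noteq> {}" using assms(2) by auto
  moreover have "connected ?R"
    by (intro connected_continuous_image continuous_intros) auto
  ultimately have "?R \<inter> frontier C \<noteq> {}" using connected_Int_frontier by blast
  then show ?thesis by auto
qed

text \<open>
  The cover is thickened to slabs in direction \<open>e\<close>, so that Lebesgue measure on the whole space can
  be used for the projection along \<open>e\<close>.
\<close>

lemma hausdorff_measure_frontier_pos:
  fixes C :: "(real^'n::finite) set"
  assumes C: "compact C" "interior C \<noteq> {}"
  shows "hausdorff_measure (power_gauge (real CARD('n) - 1)) (frontier C) > 0"
proof -
  let ?h = "power_gauge (real CARD('n) - 1)"
  have h: "?h x = x ^ (CARD('n) - 1)" if "x \<ge> 0" for x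
    using power_gauge_eq_power[OF that, of "CARD('n) - 1"] by (simp add: of_nat_diff Suc_leI)
  obtain a r where r: "r > 0" "ball a r \<subseteq> C"
    using C(2) by (meson all_not_in_conv mem_interior)
  obtain j :: 'n where True by simp
  define e where "e = (axis j 1 :: real^'n)"
  have e0: "e \<noteq> 0" by (simp add: e_def axis_eq_0_iff)
  define b where "b = measure lborel (ball a r)"
  have b: "b > 0" "emeasure lborel (ball a r) = ennreal b"
    unfolding b_def using content_ball_pos[OF r(1), of a] emeasure_lborel_ball_finite[of a r]
    by (auto intro!: emeasure_eq_ennreal_measure)
  \<comment> \<open>A slab of half-width \<open>d\<close> in n - 1 directions and \<open>r\<close>
    in direction \<open>j\<close> has volume \<open>c * d ^ (n - 1)\<close>. So the total volume of
    the slabs is \<open>c\<close> times the sum for the cover.\<close>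
  define c where "c = 2 ^ (CARD('n) - 1) * (2 * r)"
  have c: "c > 0" using r(1) by (simp add: c_def)
  have "ennreal (b / c) \<le> hausdorff_premeasure ?h 1 (frontier C)"
    unfolding hausdorff_premeasure_def
  proof (rule Inf_greatest)
    fix s assume "s \<in> {(\<Sum>i. if A i = {} then 0 else ennreal (?h (diameter (A i)))) | A :: nat \<Rightarrow> (real^'n) set.
       frontier C \<subseteq> (\<Union>i. A i) \<and> (\<forall>i. bounded (A i) \<and> diameter (A i) \<le> 1)}"
    then obtain A where A: "s = (\<Sum>i. if A i = {} then 0 else ennreal (?h (diameter (A i))))"
      "frontier C \<subseteq> (\<Union>i. A i)" "\<And>i. bounded (A i)" by blast
    define p where "p i = (SOME p. p \<in> A i)" for i
    define Q where "Q i = (if A i = {} then {} else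
      cbox (\<chi> k. if k = j then a $ j - r else p i $ k - diameter (A i))
           (\<chi> k. if k = j then a $ j + r else p i $ k + diameter (A i)))" for i
    have "ball a r \<subseteq> (\<Union>i. Q i)"
    proof
      \<comment> \<open>The ray from \<open>x\<close> along \<open>e\<close> meets the frontier in
        some \<open>A i\<close>. Moving back to \<open>x\<close> changes only coordinate
        \<open>j\<close>, hence \<open>x\<close> lies in the slab of \<open>A i\<close>.\<close>
      fix x assume x: "x \<in> ball a r"
      then obtain t where "x + t *\<^sub>R e \<in> frontier C"
        using ray_meets_frontier[OF compact_imp_bounded[OF C(1)] _ e0, of x] r(2) by blast
      then obtain i where i: "x + t *\<^sub>R e \<in> A i" using A(2) by blast
      then have pi: "p i \<in> A i" unfolding p_def by (rule someI)
      have dp: "dist (x + t *\<^sub>R e) (p i) \<le> diameter (A i)"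
        using diameter_bounded_bound[OF A(3)] i pi by blast
      have "\<bar>x $ k - p i $ k\<bar> \<le> diameter (A i)" if "k \<noteq> j" for k
        using order_trans[OF dist_vec_nth_le dp, of k] that
        by (simp add: e_def axis_def dist_real_def)
      moreover have "\<bar>x $ j - a $ j\<bar> \<le> r"
        using order_trans[OF dist_vec_nth_le[of x j a], of r] x by (simp add: dist_real_def dist_commute)
      ultimately have "x \<in> Q i" using i
        by (auto simp: Q_def mem_box_cart abs_le_iff algebra_simps)
      then show "x \<in> (\<Union>i. Q i)" by blast
    qed
    then have "emeasure lborel (ball a r) \<le> emeasure lborel (\<Union>i. Q i)"
      by (intro emeasure_mono) (auto simp: Q_def)
    also have "\<dots> \<le> (\<Sum>i. emeasure lborel (Q i))"
      by (intro emeasure_subadditive_countably) (auto simp: Q_def)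
    also have "\<dots> = (\<Sum>i. ennreal c * (if A i = {} then 0 else ennreal (?h (diameter (A i)))))"
    proof (intro suminf_cong)
      fix i
      have d: "diameter (A i) \<ge> 0" using A(3) by (rule diameter_ge_0)
      show "emeasure lborel (Q i) = ennreal c * (if A i = {} then 0 else ennreal (?h (diameter (A i))))"
        using r(1) d c emeasure_cbox_slab[OF d, of r j "a $ j" "p i"]
        by (auto simp: Q_def h c_def ennreal_mult[symmetric] power_mult_distrib mult_ac)
    qed
    also have "\<dots> = ennreal c * s" unfolding A(1) by (rule ennreal_suminf_cmult)
    finally have le: "ennreal b \<le> ennreal c * s" using b(2) by simp
    show "ennreal (b / c) \<le> s"
    proof (cases s)
      case (real q)
      then have "b \<le> c * q" using le c by (simp add: ennreal_mult[symmetric])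
      then show ?thesis using c real by (simp add: divide_le_eq mult.commute ennreal_leI)
    qed simp
  qed
  also have "\<dots> \<le> hausdorff_measure ?h (frontier C)"
    unfolding hausdorff_measure_eq_SUP by (rule SUP_upper) simp
  finally show ?thesis using b(1) c by (metis divide_pos_pos ennreal_less_zero_iff order_less_le_trans)
qed

section \<open>Hausdorff dimension from Hausdorff measures\<close>

lemma dim_H_ge:
  assumes "hausdorff_measure (power_gauge t) S > 0"
  shows "ereal t \<le> dim_H S"
  unfolding dim_H_def
proof (rule INF_greatest)
  fix s assume s: "s \<in> {s. 0 \<le> s \<and> hausdorff_measure (power_gauge s) S = 0}"
  show "ereal t \<le> ereal s"
  proof (rule ccontr)
    assume "\<not> ereal t \<le> ereal s"
    then have "hausdorff_measure (power_gauge t) S \<le> hausdorff_measure (power_gauge s) S"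
      using s by (intro hausdorff_measure_mono_gauge power_gauge_antimono) auto
    then show False using s assms by simp
  qed
qed

lemma dim_H_le:
  assumes "0 \<le> t" "\<And>k. hausdorff_measure (power_gauge (t + 1 / real (Suc k))) S = 0"
  shows "dim_H S \<le> ereal t"
proof (rule ereal_le_epsilon2)
  show "dim_H S \<le> ereal t + ereal e" if e: "0 < e" for e :: real
  proof -
    obtain k where k: "1 / real (Suc k) < e" using nat_approx_posE[OF e] by metis
    have "dim_H S \<le> ereal (t + 1 / real (Suc k))"
      unfolding dim_H_def using assms by (intro INF_lower) auto
    also have "\<dots> \<le> ereal t + ereal e" using k by simp
    finally show ?thesis .
  qed
qed

section \<open>Generic maps\<close>

lemma cont_maps_iff:
  assumes "compact K"
  shows "f \<in> mspace (cont_maps K) \<longleftrightarrow> f \<in> extensional K \<and> continuous_on K f"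
proof -
  have "bounded (f ` K)" if "continuous_on K f"
    using compact_continuous_image[OF that assms] by (rule compact_imp_bounded)
  then show ?thesis
    unfolding cont_maps_def mspace_cfunspace_euclidean by auto
qed

lemma mdist_cont_maps_less_imp:
  assumes "f \<in> mspace (cont_maps K)" "g \<in> mspace (cont_maps K)" "mdist (cont_maps K) f g < r" "x \<in> K"
  shows "dist (f x) (g x) < r"
proof -
  have "mdist euclidean_metric (f x) (g x) \<le> mdist (cont_maps K) f g"
    unfolding cont_maps_def
    by (rule mdist_cfunspace_imp_mdist_le[OF assms(1,2)[unfolded cont_maps_def] order_refl]) (simp add: assms(4))
  then show ?thesis using assms(3) by simp
qed

lemma mdist_cont_maps_le:
  assumes "0 \<le> B" "\<And>x. x \<in> K \<Longrightarrow> dist (f x) (g x) \<le> B"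
  shows "mdist (cont_maps K) f g \<le> B"
  unfolding cont_maps_def
proof (rule mdist_cfunspace_le[OF assms(1)])
  fix x assume "x \<in> topspace (top_of_set K)"
  then have "x \<in> K" by simp
  then show "mdist euclidean_metric (f x) (g x) \<le> B"
    unfolding mdist_euclidean_metric by (rule assms(2))
qed

section \<open>Meager sets and generic properties\<close>

lemma nowhere_dense_in_subset:
  assumes "nowhere_dense_in X N" "N' \<subseteq> N"
  shows "nowhere_dense_in X N'"
proof -
  have "X interior_of (X closure_of N') \<subseteq> X interior_of (X closure_of N)"
    using assms(2) by (intro interior_of_mono closure_of_mono)
  then show ?thesis using assms unfolding nowhere_dense_in_def by blast
qed

lemma meager_in_subset:
  assumes "meager_in X S" "T \<subseteq> S"
  shows "meager_in X T"
proof -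
  obtain \<N> where N: "countable \<N>" "\<And>N. N \<in> \<N> \<Longrightarrow> nowhere_dense_in X N" "S = \<Union>\<N>"
    using assms(1) unfolding meager_in_def by blast
  have "countable ((\<inter>) T ` \<N>)" using N(1) by simp
  moreover have "\<forall>N\<in>(\<inter>) T ` \<N>. nowhere_dense_in X N"
    using N(2) nowhere_dense_in_subset by blast
  moreover have "T = \<Union>((\<inter>) T ` \<N>)" using N(3) assms(2) by blast
  ultimately show ?thesis unfolding meager_in_def by blast
qed

lemma meager_in_UN:
  assumes "\<And>k::nat. meager_in X (S k)"
  shows "meager_in X (\<Union>k. S k)"
proof -
  have "\<forall>k. \<exists>\<N>. countable \<N> \<and> (\<forall>N\<in>\<N>. nowhere_dense_in X N) \<and> S k = \<Union>\<N>"
    using assms unfolding meager_in_def by blast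
  then obtain \<N> where "\<And>k. countable (\<N> k)" "\<And>k. \<forall>N\<in>\<N> k. nowhere_dense_in X N" "\<And>k. S k = \<Union>(\<N> k)"
    by metis
  then show ?thesis unfolding meager_in_def by (intro exI[of _ "\<Union>k. \<N> k"]) auto
qed

lemma generic_map_mono:
  assumes "generic_map K P" "\<And>f. P f \<Longrightarrow> Q f"
  shows "generic_map K Q"
proof -
  let ?X = "mtopology_of (cont_maps K) :: ('a \<Rightarrow> 'b) topology"
  have "topspace ?X - {f \<in> mspace (cont_maps K). Q f} \<subseteq> topspace ?X - {f \<in> mspace (cont_maps K). P f}"
    using assms(2) by blast
  then show ?thesis using assms(1) meager_in_subset
    unfolding generic_map_def comeager_in_def by auto
qed

lemma generic_map_countable:
  assumes "\<And>k::nat. generic_map K (P k)"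
  shows "generic_map K (\<lambda>f. \<forall>k. P k f)"
proof -
  let ?X = "mtopology_of (cont_maps K) :: ('a \<Rightarrow> 'b) topology"
  have "meager_in ?X (topspace ?X - {f \<in> mspace (cont_maps K). P k f})" for k
    using assms[of k] unfolding generic_map_def comeager_in_def by blast
  from meager_in_UN[OF this]
  have "meager_in ?X (\<Union>k. topspace ?X - {f \<in> mspace (cont_maps K). P k f})" .
  moreover have "(\<Union>k. topspace ?X - {f \<in> mspace (cont_maps K). P k f}) =
      topspace ?X - {f \<in> mspace (cont_maps K). \<forall>k. P k f}"
    by auto
  ultimately show ?thesis unfolding generic_map_def comeager_in_def by auto
qed

lemma generic_map_conj:
  assumes "generic_map K P" "generic_map K Q"
  shows "generic_map K (\<lambda>f. P f \<and> Q f)"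
proof -
  have "generic_map K (\<lambda>f. \<forall>k::nat. (if k = 0 then P else Q) f)"
    by (rule generic_map_countable) (simp add: assms)
  then show ?thesis
  proof (rule generic_map_mono)
    fix f assume all: "\<forall>k::nat. (if k = 0 then P else Q) f"
    show "P f \<and> Q f" using spec[OF all, of 0] spec[OF all, of 1] by simp
  qed
qed

text \<open>Every ball contains a smaller ball on which \<open>P\<close> holds throughout, so the
  maps without \<open>P\<close> form a nowhere dense set. The \<open>g\<close> supplied by
  \<open>dense\<close> is arbitrary off \<open>K\<close>; restricting it to \<open>K\<close> turns
  it into an element of the space.\<close>

lemma generic_mapI:
  fixes P :: "('a::metric_space \<Rightarrow> 'b::metric_space) \<Rightarrow> bool"
  assumes K: "compact K"
    and dense: "\<And>f e. continuous_on K f \<Longrightarrow> e > 0 \<Longrightarrow> \<exists>g d. continuous_on K g \<and> (\<forall>x\<in>K. dist (f x) (g x) \<le> e) \<and> d > 0 \<and>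
      (\<forall>u. continuous_on K u \<longrightarrow> (\<forall>x\<in>K. dist (g x) (u x) < d) \<longrightarrow> P u)"
  shows "generic_map K P"
proof -
  let ?M = "cont_maps K :: ('a \<Rightarrow> 'b) metric"
  let ?X = "mtopology_of ?M"
  define N where "N = {f \<in> mspace ?M. \<not> P f}"
  have "?X interior_of (?X closure_of N) = {}"
  proof (rule ccontr)
    assume "\<not> ?thesis"
    then obtain f where f: "f \<in> ?X interior_of (?X closure_of N)" by blast
    moreover have "openin ?X (?X interior_of (?X closure_of N))" by (rule openin_interior_of)
    ultimately obtain r where r: "r > 0" "f \<in> mspace ?M"
      "\<And>g. g \<in> mspace ?M \<Longrightarrow> mdist ?M f g < r \<Longrightarrow> g \<in> ?X interior_of (?X closure_of N)"
      unfolding openin_mtopology_of_iff by blast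
    have cf: "continuous_on K f" using r(2) cont_maps_iff[OF K] by blast
    obtain g d where g: "continuous_on K g" "\<And>x. x \<in> K \<Longrightarrow> dist (f x) (g x) \<le> r / 2" "d > 0"
      "\<And>u. continuous_on K u \<Longrightarrow> (\<forall>x\<in>K. dist (g x) (u x) < d) \<Longrightarrow> P u"
      using dense[OF cf, of "r / 2"] r(1) by auto
    let ?g = "restrict g K"
    have "continuous_on K ?g"
      using g(1) by (rule continuous_on_eq) simp
    then have gM: "?g \<in> mspace ?M" by (simp only: cont_maps_iff[OF K] restrict_extensional)
    have "mdist ?M f ?g \<le> r / 2" using g(2) r(1) by (intro mdist_cont_maps_le) simp_all
    then have "?g \<in> ?X interior_of (?X closure_of N)" using r(1) by (intro r(3)[OF gM]) linarith
    then have "?g \<in> ?X closure_of N" by (rule subsetD[OF interior_of_subset])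
    then have "\<forall>r>0. \<exists>u\<in>N. u \<in> Metric_space.mball (mspace ?M) (mdist ?M) ?g r"
      unfolding mtopology_of_def Metric_space.metric_closure_of[OF Metric_space_mspace_mdist] by blast
    then obtain u where u: "u \<in> N" "mdist ?M ?g u < d"
      using g(3) unfolding Metric_space.in_mball[OF Metric_space_mspace_mdist] by blast
    then have "u \<in> mspace ?M" by (simp add: N_def)
    then have "continuous_on K u" "\<forall>x\<in>K. dist (?g x) (u x) < d"
      using cont_maps_iff[OF K] mdist_cont_maps_less_imp[OF gM _ u(2)] by blast+
    then have "continuous_on K u" "\<forall>x\<in>K. dist (g x) (u x) < d" by simp_all
    then have "P u" by (rule g(4))
    then show False using u(1) by (simp add: N_def)
  qed
  then have "nowhere_dense_in ?X N" unfolding nowhere_dense_in_def by (auto simp: N_def)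
  moreover have "topspace ?X - {f \<in> mspace ?M. P f} = N" by (auto simp: N_def)
  ultimately show ?thesis unfolding generic_map_def comeager_in_def meager_in_def
    by (auto intro!: exI[of _ "{N}"])
qed

lemma generic_map_mono_on:
  assumes K: "compact K" and "generic_map K P" "\<And>f. continuous_on K f \<Longrightarrow> P f \<Longrightarrow> Q f"
  shows "generic_map K Q"
proof -
  have "generic_map K (\<lambda>f. continuous_on K f)"
    by (rule generic_mapI[OF K]) (metis dist_self less_imp_le zero_less_one)
  from generic_map_conj[OF this assms(2)] show ?thesis
    by (rule generic_map_mono) (use assms(3) in blast)
qed

text \<open>Tietze's theorem is applied to each coordinate; the radial retraction onto the ball of
  radius \<open>B\<close> then enforces the norm bound without changing the values on
  \<open>L\<close>.\<close>

lemma Tietze_compact_vec: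
  fixes w :: "'a::metric_space \<Rightarrow> real^'n::finite"
  assumes K: "compact K" and L: "closed L" "L \<subseteq> K" and w: "continuous_on L w"
    and B: "B > 0" "\<And>x. x \<in> L \<Longrightarrow> norm (w x) \<le> B"
  shows "\<exists>W. continuous_on K W \<and> (\<forall>x\<in>L. W x = w x) \<and> (\<forall>x\<in>K. norm (W x) \<le> B)"
proof -
  have "normal_space (top_of_set K)"
    using metrizable_imp_normal_space metrizable_space_subtopology metrizable_space_euclidean by blast
  moreover have "closedin (top_of_set K) L" using L by (rule closed_subset[rotated])
  moreover have "continuous_map (subtopology (top_of_set K) L) euclidean (\<lambda>x. w x $ i)" for i
    using w L(2) by (auto simp: subtopology_subtopology Int_absorb1 intro!: continuous_intros)
  ultimately have "\<forall>i. \<exists>g. continuous_map (top_of_set K) euclidean g \<and> (\<forall>x\<in>L. g x = w x $ i)"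
    unfolding normal_space_iff_Tietze by blast
  then obtain g where g: "\<And>i. continuous_on K (g i)" "\<And>i x. x \<in> L \<Longrightarrow> g i x = w x $ i"
    by (metis continuous_map_iff_continuous)
  define V where "V x = (\<chi> i. g i x)" for x
  have cV: "continuous_on K V" unfolding V_def using g(1) by (intro continuous_intros)
  have Vw: "V x = w x" if "x \<in> L" for x using g(2)[OF that] by (simp add: V_def vec_eq_iff)
  define W where "W x = (B / max B (norm (V x))) *\<^sub>R V x" for x
  have m: "max B (norm (V x)) > 0" for x using B(1) by simp
  have "continuous_on K W" unfolding W_def
    using cV m by (intro continuous_intros) (auto simp: less_imp_neq[symmetric])
  moreover have "W x = w x" if "x \<in> L" for x
    using Vw[OF that] B(2)[OF that] B(1) by (simp add: W_def max_absorb1)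
  moreover have "norm (W x) \<le> B" for x
    using B(1) m[of x] by (simp add: W_def field_simps)
  ultimately show ?thesis by blast
qed

text \<open>Some small ball \<open>L\<close> in \<open>K\<close> is still of large dimension, so it
  carries a map \<open>f0\<close> such that every map close to \<open>f0\<close> has a zero. If
  \<open>g\<close> is a scaled copy of \<open>f0\<close> around \<open>f x\<close> on
  \<open>L\<close>, this persistence of zeros means that every map near \<open>g\<close> takes all
  values near \<open>f x\<close>.\<close>

lemma generic_map_interior_nonempty:
  fixes K :: "'a::metric_space set"
  assumes K: "compact K" and nd: "\<not> top_of_set K dim_le (int CARD('n::finite) - 1)"
  shows "generic_map K (\<lambda>f :: 'a \<Rightarrow> real^'n. interior (f ` K) \<noteq> {})"
proof (rule generic_mapI[OF K])
  fix f :: "'a \<Rightarrow> real^'n" and e :: real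
  assume f: "continuous_on K f" and e: "e > 0"
  obtain x where x: "x \<in> K" "\<And>r. r > 0 \<Longrightarrow> \<not> top_of_set (K \<inter> cball x r) dim_le (int CARD('n) - 1)"
    using dim_le_localize[OF nd] by auto
  have "\<exists>d>0. \<forall>y\<in>K. dist y x < d \<longrightarrow> dist (f y) (f x) < e / 2"
    using f x(1) e unfolding continuous_on_iff by (meson half_gt_zero)
  then obtain d where d: "d > 0" "\<And>y. y \<in> K \<Longrightarrow> dist y x < d \<Longrightarrow> dist (f y) (f x) < e / 2" by blast
  define L where "L = K \<inter> cball x (d / 2)"
  have L: "compact L" "L \<subseteq> K" "closed L" using K
    by (auto simp: L_def compact_Int_closed compact_imp_closed)
  have fL: "dist (f y) (f x) < e / 2" if "y \<in> L" for y
    using that d(1) by (intro d(2)) (auto simp: L_def dist_commute)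
  have "\<not> top_of_set L dim_le (int CARD('n) - 1)" using x(2)[of "d / 2"] d(1) by (simp add: L_def)
  then obtain f0 :: "'a \<Rightarrow> real^'n" and e0 where f0: "continuous_on L f0" "e0 > 0"
    "\<And>g. continuous_on L g \<Longrightarrow> \<forall>z\<in>L. dist (g z) (f0 z) < e0 \<Longrightarrow> \<exists>z\<in>L. g z = 0"
    using dim_le_if_zero_avoidable[OF L(1), where 'n='n] by blast
  obtain B where B: "B > 0" "\<And>z. z \<in> L \<Longrightarrow> norm (f0 z) \<le> B"
    using compact_imp_bounded[OF compact_continuous_image[OF f0(1) L(1)]] unfolding bounded_pos by blast
  \<comment> \<open>Gives \<open>norm (c *\<^sub>R f0 z) \<le> e / 2\<close>; the other half of
    \<open>e\<close> pays for the variation of \<open>f\<close> on \<open>L\<close>.\<close>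
  define c where "c = e / (2 * B)"
  have c: "c > 0" using e B(1) by (simp add: c_def)
  have "continuous_on L (\<lambda>z. f x + c *\<^sub>R f0 z - f z)"
    using f0(1) continuous_on_subset[OF f L(2)] by (intro continuous_intros)
  moreover have "norm (f x + c *\<^sub>R f0 z - f z) \<le> e" if "z \<in> L" for z
  proof -
    have "norm (c *\<^sub>R f0 z) \<le> e / 2"
      using B(2)[OF that] B(1) e by (simp add: c_def field_simps)
    moreover have "norm (f x - f z) < e / 2" using fL[OF that] by (simp add: dist_norm norm_minus_commute)
    moreover have "f x + c *\<^sub>R f0 z - f z = c *\<^sub>R f0 z + (f x - f z)" by simp
    ultimately show ?thesis
      using norm_triangle_ineq[of "c *\<^sub>R f0 z" "f x - f z"] by (metis add_mono field_sum_of_halves less_imp_le order_trans)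
  qed
  ultimately obtain W where W: "continuous_on K W" "\<And>z. z \<in> L \<Longrightarrow> W z = f x + c *\<^sub>R f0 z - f z"
      "\<And>z. z \<in> K \<Longrightarrow> norm (W z) \<le> e"
    using Tietze_compact_vec[OF K L(3,2), of "\<lambda>z. f x + c *\<^sub>R f0 z - f z" e] e by blast
  define g where "g z = f z + W z" for z
  have gL: "g z = f x + c *\<^sub>R f0 z" if "z \<in> L" for z using W(2)[OF that] by (simp add: g_def)
  show "\<exists>g d. continuous_on K g \<and> (\<forall>x\<in>K. dist (f x) (g x) \<le> e) \<and> d > 0 \<and>
      (\<forall>u. continuous_on K u \<longrightarrow> (\<forall>x\<in>K. dist (g x) (u x) < d) \<longrightarrow> interior (u ` K) \<noteq> {})"
  proof (intro exI[of _ g] exI[of _ "c * e0 / 2"] conjI ballI allI impI)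
    show "continuous_on K g" unfolding g_def using f W(1) by (intro continuous_intros)
    show "dist (f z) (g z) \<le> e" if "z \<in> K" for z using W(3)[OF that] by (simp add: g_def dist_norm)
    show "c * e0 / 2 > 0" using c f0(2) by simp
    fix u assume u: "continuous_on K u" "\<forall>z\<in>K. dist (g z) (u z) < c * e0 / 2"
    have "ball (f x) (c * e0 / 2) \<subseteq> u ` K"
    proof
      fix y assume y: "y \<in> ball (f x) (c * e0 / 2)"
      \<comment> \<open>A zero of \<open>v\<close> is a point where \<open>u\<close> takes the value
        \<open>y\<close>. After scaling by \<open>c\<close>, the tolerance \<open>e0\<close> is
        shared equally by \<open>u - g\<close> and \<open>f x - y\<close>.\<close>
      define v where "v z = (1 / c) *\<^sub>R (u z - y)" for z
      have "continuous_on L v" unfolding v_def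
        using continuous_on_subset[OF u(1) L(2)] by (intro continuous_intros)
      moreover have "dist (v z) (f0 z) < e0" if z: "z \<in> L" for z
      proof -
        have "dist (v z) (f0 z) = (1 / c) * norm ((u z - g z) + (f x - y))"
        proof -
          have "v z - f0 z = (1 / c) *\<^sub>R ((u z - g z) + (f x - y))"
            using c by (simp add: v_def gL[OF z] scaleR_right_diff_distrib scaleR_right_distrib)
          then show ?thesis using c by (simp add: dist_norm)
        qed
        also have "\<dots> < (1 / c) * (c * e0)"
        proof -
          have "norm (u z - g z) < c * e0 / 2" using u(2) z L(2) by (auto simp: dist_norm norm_minus_commute)
          moreover have "norm (f x - y) < c * e0 / 2" using y by (simp add: dist_norm)
          ultimately have "norm ((u z - g z) + (f x - y)) < c * e0"
            using norm_triangle_ineq[of "u z - g z" "f x - y"] by linarith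
          then show ?thesis using c by (intro mult_strict_left_mono) auto
        qed
        finally show ?thesis using c by simp
      qed
      ultimately obtain z where "z \<in> L" "v z = 0" using f0(3) by blast
      then have "u z = y" using c by (simp add: v_def)
      then show "y \<in> u ` K" using \<open>z \<in> L\<close> L(2) by blast
    qed
    then have "f x \<in> interior (u ` K)" using c f0(2) by (simp add: mem_interior) (meson half_gt_zero mult_pos_pos zero_less_divide_iff)
    then show "interior (u ` K) \<noteq> {}" by blast
  qed
qed

section \<open>Boundaries near the skeleton of a grid\<close>

text \<open>Up to a constant factor, \<open>1 / \<tau> ^ (n - 1)\<close> boxes of diameter at most
  \<open>d = 4 * n * \<tau>\<close> cover the set. As \<open>h d\<close> is small against
  \<open>d ^ (n - 1)\<close>, the sum tends to 0 with \<open>\<tau>\<close>.\<close>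

lemma hausdorff_premeasure_grid_neighbourhood:
  fixes G :: "real set"
  assumes G: "finite G" and R: "R > 0" and h: "gauge_function h"
    and lim: "((\<lambda>r. h r / r ^ (CARD('n::finite) - 1)) \<longlongrightarrow> 0) (at_right 0)"
    and pos: "\<delta> > 0" "\<epsilon> > 0"
  shows "\<exists>\<tau>0>0. \<forall>\<tau>. 0 < \<tau> \<and> \<tau> < \<tau>0 \<longrightarrow>
    hausdorff_premeasure h \<delta> {y :: real^'n. (\<forall>i. \<bar>y $ i\<bar> \<le> R) \<and> (\<exists>i. \<exists>\<gamma>\<in>G. \<bar>y $ i - \<gamma>\<bar> \<le> 2 * \<tau>)} < ennreal \<epsilon>"
proof -
  let ?n = "CARD('n)"
  \<comment> \<open>An upper bound for \<open>card I * d ^ (n - 1)\<close> below, by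
    \<open>m * \<tau> \<le> 2 * R + 1\<close>. Adding 1 keeps it positive when \<open>G\<close> is
    empty.\<close>
  define c where "c = real ?n * real (card G) * ((2 * R + 1) * (4 * real ?n)) ^ (?n - 1) + 1"
  have n0: "real ?n > 0" by simp
  have c: "c > 0" unfolding c_def using R by (intro add_nonneg_pos mult_nonneg_nonneg zero_le_power) auto
  have "eventually (\<lambda>r. \<bar>h r / r ^ (?n - 1)\<bar> < \<epsilon> / c) (at_right 0)"
    using lim pos(2) c unfolding tendsto_iff dist_real_def by simp
  then obtain r0 where r0: "r0 > 0" "\<And>r. 0 < r \<Longrightarrow> r < r0 \<Longrightarrow> \<bar>h r / r ^ (?n - 1)\<bar> < \<epsilon> / c"
    unfolding eventually_at_right_field by auto
  define \<tau>0 where "\<tau>0 = min 1 (min r0 \<delta> / (4 * real ?n))"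
  have "\<tau>0 > 0" unfolding \<tau>0_def using r0(1) pos(1) n0 by simp
  moreover have "hausdorff_premeasure h \<delta> {y :: real^'n. (\<forall>i. \<bar>y $ i\<bar> \<le> R) \<and> (\<exists>i. \<exists>\<gamma>\<in>G. \<bar>y $ i - \<gamma>\<bar> \<le> 2 * \<tau>)} < ennreal \<epsilon>"
    (is "hausdorff_premeasure h \<delta> ?S < _")
    if \<tau>: "0 < \<tau>" "\<tau> < \<tau>0" for \<tau>
  proof -
    define d where "d = 4 * real ?n * \<tau>"
    have "\<tau> < min r0 \<delta> / (4 * real ?n)" using \<tau>(2) by (simp add: \<tau>0_def)
    then have "d < min r0 \<delta>" using n0 by (simp add: d_def field_simps)
    then have d: "d > 0" "d < r0" "d \<le> \<delta>" using \<tau> n0 by (auto simp: d_def)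
    have \<tau>1: "\<tau> < 1" using \<tau>(2) by (simp add: \<tau>0_def)
    \<comment> \<open>The extra 1 lets the indices below \<open>m\<close> also reach the coordinate
      value \<open>R\<close>.\<close>
    define m where "m = nat \<lfloor>2 * R / \<tau>\<rfloor> + 1"
    have "real m \<le> 2 * R / \<tau> + 1" using R \<tau>(1) by (simp add: m_def)
    then have m\<tau>: "real m * \<tau> \<le> 2 * R + 1" using \<tau>(1) \<tau>1 by (simp add: field_simps)
    \<comment> \<open>Across the hyperplane, in direction \<open>i\<close>, there is no subdivision:
      the index is fixed at 0, which leaves \<open>m ^ (n - 1)\<close> choices.\<close>
    define P where "P i = PiE UNIV (\<lambda>j. if j = i then {0} else {..<m})" for i :: 'n
    define I where "I = Sigma (UNIV \<times> G) (\<lambda>p. P (fst p))"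
    define B :: "('n \<times> real) \<times> ('n \<Rightarrow> nat) \<Rightarrow> (real^'n) set"
      where "B q = cbox (\<chi> j. if j = fst (fst q) then snd (fst q) - 2 * \<tau> else - R + real (snd q j) * \<tau>)
                        (\<chi> j. if j = fst (fst q) then snd (fst q) + 2 * \<tau> else - R + real (snd q j) * \<tau> + \<tau>)" for q
    have finP: "finite (P i)" for i unfolding P_def by (intro finite_PiE) auto
    have cardP: "card (P i) = m ^ (?n - 1)" for i
    proof -
      have "card (P i) = (\<Prod>j\<in>UNIV. card (if j = i then {0} else {..<m}))"
        unfolding P_def by (rule card_PiE) simp
      also have "\<dots> = (\<Prod>j\<in>UNIV. if j = i then 1 else m)" by (intro prod.cong) auto
      also have "\<dots> = m ^ (?n - 1)"
        by (subst prod.remove[of _ i]) (auto simp: card_Diff_singleton intro!: prod.cong)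
      finally show ?thesis .
    qed
    have finI: "finite I" unfolding I_def using G finP by (intro finite_SigmaI) auto
    have cardI: "card I = ?n * card G * m ^ (?n - 1)"
      unfolding I_def using G finP by (subst card_SigmaI) (auto simp: cardP card_cartesian_product)
    have "?S \<subseteq> (\<Union>q\<in>I. B q)"
    proof
      fix y assume "y \<in> ?S"
      then obtain i \<gamma> where y: "\<And>j. \<bar>y $ j\<bar> \<le> R" "\<gamma> \<in> G" "\<bar>y $ i - \<gamma>\<bar> \<le> 2 * \<tau>" by blast
      define k where "k j = (if j = i then 0 else nat \<lfloor>(y $ j + R) / \<tau>\<rfloor>)" for j
      have ge0: "0 \<le> (y $ j + R) / \<tau>" for j using y(1)[of j] \<tau>(1) by (simp add: abs_le_iff)
      have k0: "k i = 0" by (simp add: k_def)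
      have km: "k j < m" for j
      proof -
        have "(y $ j + R) / \<tau> \<le> 2 * R / \<tau>" using y(1)[of j] \<tau>(1) by (intro divide_right_mono) auto
        then have "nat \<lfloor>(y $ j + R) / \<tau>\<rfloor> \<le> nat \<lfloor>2 * R / \<tau>\<rfloor>" by (intro nat_mono floor_mono)
        then show ?thesis by (simp add: k_def m_def)
      qed
      have "((i, \<gamma>), k) \<in> I" using y(2) k0 km by (auto simp: I_def P_def)
      moreover have "y \<in> B ((i, \<gamma>), k)"
      proof -
        have "- R + real (k j) * \<tau> \<le> y $ j \<and> y $ j \<le> - R + real (k j) * \<tau> + \<tau>" if "j \<noteq> i" for j
        proof -
          have k: "real (k j) = of_int \<lfloor>(y $ j + R) / \<tau>\<rfloor>" using ge0[of j] that by (simp add: k_def)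
          have "real (k j) \<le> (y $ j + R) / \<tau>" "(y $ j + R) / \<tau> \<le> real (k j) + 1"
            unfolding k by linarith+
          then have "real (k j) * \<tau> \<le> y $ j + R" "y $ j + R \<le> (real (k j) + 1) * \<tau>"
            using \<tau>(1) by (simp_all add: pos_le_divide_eq pos_divide_le_eq)
          then show ?thesis by (simp add: algebra_simps)
        qed
        moreover have "\<gamma> - 2 * \<tau> \<le> y $ i" "y $ i \<le> \<gamma> + 2 * \<tau>" using y(3) by (auto simp: abs_le_iff)
        ultimately show ?thesis by (simp add: B_def mem_box_cart)
      qed
      ultimately show "y \<in> (\<Union>q\<in>I. B q)" by blast
    qed
    moreover have "bounded (B q) \<and> diameter (B q) \<le> d" for q
    proof
      show "bounded (B q)" by (simp add: B_def)
      show "diameter (B q) \<le> d"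
      proof (rule diameter_le)
        fix x y assume xy: "x \<in> B q" "y \<in> B q"
        have "\<bar>(x - y) $ j\<bar> \<le> 4 * \<tau>" for j
        proof -
          have "\<bar>x $ j - y $ j\<bar> \<le> 4 * \<tau>"
            using xy \<tau>(1) unfolding B_def mem_box_cart
            by (cases "j = fst (fst q)") (auto dest!: spec[of _ j])
          then show ?thesis by simp
        qed
        then have "(\<Sum>j\<in>UNIV. \<bar>(x - y) $ j\<bar>) \<le> (\<Sum>j\<in>(UNIV::'n set). 4 * \<tau>)"
          by (intro sum_mono) auto
        then show "norm (x - y) \<le> d"
          using norm_le_l1_cart[of "x - y"] by (simp add: d_def)
      qed (use d in auto)
    qed
    ultimately have "hausdorff_premeasure h \<delta> ?S \<le> ennreal (real (card I) * h d)"
      using d by (intro hausdorff_premeasure_le_finite_cover[OF finI _ _ _ _ h, of _ B]) auto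
    also have "\<dots> < ennreal \<epsilon>"
    proof -
      have hd: "0 \<le> h d / d ^ (?n - 1)" using h d(1) by (simp add: gauge_function_def)
      have dn: "d ^ (?n - 1) > 0" using d(1) by simp
      have "real (card I) * h d = real ?n * real (card G) * ((real m * \<tau>) * (4 * real ?n)) ^ (?n - 1) * (h d / d ^ (?n - 1))"
        using dn \<tau>(1) n0 by (simp add: cardI d_def power_mult_distrib field_simps)
      also have "\<dots> \<le> c * (h d / d ^ (?n - 1))"
      proof (rule mult_right_mono[OF _ hd])
        have "((real m * \<tau>) * (4 * real ?n)) ^ (?n - 1) \<le> ((2 * R + 1) * (4 * real ?n)) ^ (?n - 1)"
          using m\<tau> \<tau>(1) n0 by (intro power_mono mult_right_mono) auto
        then have "real ?n * real (card G) * ((real m * \<tau>) * (4 * real ?n)) ^ (?n - 1) \<le>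
            real ?n * real (card G) * ((2 * R + 1) * (4 * real ?n)) ^ (?n - 1)"
          by (intro mult_left_mono) auto
        then show "real ?n * real (card G) * ((real m * \<tau>) * (4 * real ?n)) ^ (?n - 1) \<le> c"
          unfolding c_def by linarith
      qed
      also have "\<dots> < c * (\<epsilon> / c)"
        using order_le_less_trans[OF abs_ge_self r0(2)[OF d(1,2)]] c by (rule mult_strict_left_mono)
      also have "\<dots> = \<epsilon>" using c by simp
      finally show ?thesis using pos(2) by (simp add: ennreal_lessI)
    qed
    finally show ?thesis .
  qed
  ultimately show ?thesis by blast
qed

text \<open>Induction on the points. If all maps near \<open>g\<close> hit \<open>c\<close>, only
  the radius shrinks; otherwise some nearby \<open>v\<close> misses \<open>c\<close>, and hence a
  ball around \<open>c\<close>, because its image is compact. The alternatives already decided pass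
  to smaller neighbourhoods, and half the radius is reserved for moving from \<open>g\<close> to
  \<open>v\<close>.\<close>

lemma avoid_or_stable:
  fixes f :: "'a::metric_space \<Rightarrow> 'b::real_normed_vector"
  assumes K: "compact K" and f: "continuous_on K f" and \<Gamma>: "finite \<Gamma>" and e: "e > 0"
  shows "\<exists>g \<eta>. continuous_on K g \<and> (\<forall>x\<in>K. dist (f x) (g x) < e) \<and> \<eta> > 0 \<and>
    (\<forall>c\<in>\<Gamma>. (\<forall>u. continuous_on K u \<and> (\<forall>x\<in>K. dist (g x) (u x) < \<eta>) \<longrightarrow> c \<notin> u ` K) \<or>
           (\<forall>u. continuous_on K u \<and> (\<forall>x\<in>K. dist (g x) (u x) < \<eta>) \<longrightarrow> c \<in> u ` K))"
  using \<Gamma> e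
proof (induction arbitrary: e)
  case empty
  then show ?case using f by (intro exI[of _ f] exI[of _ 1]) simp
next
  case (insert c \<Gamma>)
  obtain g \<eta> where g: "continuous_on K g" "\<And>x. x \<in> K \<Longrightarrow> dist (f x) (g x) < e / 2" "\<eta> > 0"
    "\<And>c. c \<in> \<Gamma> \<Longrightarrow> (\<forall>u. continuous_on K u \<and> (\<forall>x\<in>K. dist (g x) (u x) < \<eta>) \<longrightarrow> c \<notin> u ` K) \<or>
           (\<forall>u. continuous_on K u \<and> (\<forall>x\<in>K. dist (g x) (u x) < \<eta>) \<longrightarrow> c \<in> u ` K)"
    using insert.IH[of "e / 2"] insert.prems by auto
  define \<mu> where "\<mu> = min (\<eta> / 2) (e / 2)"
  have \<mu>: "\<mu> > 0" "\<mu> \<le> \<eta> / 2" "\<mu> \<le> e / 2" using g(3) insert.prems by (auto simp: \<mu>_def)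
  show ?case
  proof (cases "\<forall>u. continuous_on K u \<and> (\<forall>x\<in>K. dist (g x) (u x) < \<mu>) \<longrightarrow> c \<in> u ` K")
    case True
    have fg: "\<forall>x\<in>K. dist (f x) (g x) < e"
      using g(2) insert.prems by fastforce
    have gu: "\<forall>x\<in>K. dist (g x) (u x) < \<eta>" if "\<forall>x\<in>K. dist (g x) (u x) < \<mu>" for u
      using that \<mu>(2) g(3) by fastforce
    have "(\<forall>u. continuous_on K u \<and> (\<forall>x\<in>K. dist (g x) (u x) < \<mu>) \<longrightarrow> c' \<notin> u ` K) \<or>
           (\<forall>u. continuous_on K u \<and> (\<forall>x\<in>K. dist (g x) (u x) < \<mu>) \<longrightarrow> c' \<in> u ` K)" if "c' \<in> \<Gamma>" for c'
      using g(4)[OF that] gu by meson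
    then show ?thesis
      using g(1) fg \<mu>(1) True by (intro exI[of _ g] exI[of _ \<mu>]) blast
  next
    case False
    then obtain v where v: "continuous_on K v" "\<And>x. x \<in> K \<Longrightarrow> dist (g x) (v x) < \<mu>" "c \<notin> v ` K" by blast
    have "compact (v ` K)" using v(1) K by (rule compact_continuous_image)
    then have "open (- (v ` K))" by (simp add: compact_imp_closed open_Compl)
    then obtain d where d: "d > 0" "ball c d \<subseteq> - (v ` K)"
      using v(3) openE[of "- (v ` K)" c] by (metis ComplI)
    define \<nu> where "\<nu> = min (\<eta> / 2) d"
    have \<nu>: "\<nu> > 0" "\<nu> \<le> \<eta> / 2" "\<nu> \<le> d" using g(3) d(1) by (auto simp: \<nu>_def)
    have fv: "dist (f x) (v x) < e" if "x \<in> K" for x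
      using g(2)[OF that] v(2)[OF that] \<mu>(3) dist_triangle[of "f x" "v x" "g x"] by linarith
    have gu: "dist (g x) (u x) < \<eta>" if "x \<in> K" "dist (v x) (u x) < \<nu>" for x u
      using that v(2)[OF that(1)] \<mu>(2) \<nu>(2) dist_triangle[of "g x" "u x" "v x"] by linarith
    have "c \<notin> u ` K" if u: "\<forall>x\<in>K. dist (v x) (u x) < \<nu>" for u
    proof
      assume "c \<in> u ` K"
      then obtain x where x: "x \<in> K" "c = u x" by blast
      then have "v x \<in> ball c d" using u \<nu>(3) by (force simp: dist_commute)
      then show False using d(2) x(1) by blast
    qed
    moreover have "(\<forall>u. continuous_on K u \<and> (\<forall>x\<in>K. dist (v x) (u x) < \<nu>) \<longrightarrow> c' \<notin> u ` K) \<or>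
           (\<forall>u. continuous_on K u \<and> (\<forall>x\<in>K. dist (v x) (u x) < \<nu>) \<longrightarrow> c' \<in> u ` K)" if "c' \<in> \<Gamma>" for c'
      using g(4)[OF that] gu by meson
    ultimately show ?thesis
      using v(1) fv \<nu>(1) by (intro exI[of _ v] exI[of _ \<nu>]) blast
  qed
qed

lemma norm_le_card_mult:
  fixes v :: "real^'n::finite"
  assumes "\<And>i. \<bar>v $ i\<bar> \<le> b"
  shows "norm v \<le> real CARD('n) * b"
proof -
  have "(\<Sum>i\<in>UNIV. \<bar>v $ i\<bar>) \<le> (\<Sum>i\<in>(UNIV::'n set). b)" by (intro sum_mono assms)
  then show ?thesis using norm_le_l1_cart[of v] by simp
qed

text \<open>
  On each cell of the grid, \<open>r\<close> stretches the interval of radius \<open>t\<close> around the centre over the whole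
  cell and collapses the rest to the end points.
\<close>

lemma expanding_staircase:
  fixes a s t :: real and m :: nat
  assumes t: "0 < t" "t < s / 2" and m: "m > 0"
  defines "cen \<equiv> \<lambda>j::nat. a + (real j + 1 / 2) * s"
  shows "\<exists>r. continuous_on UNIV r \<and>
    (\<forall>x. a \<le> x \<and> x \<le> a + real m * s \<longrightarrow> \<bar>r x - x\<bar> \<le> s \<and> a \<le> r x \<and> r x \<le> a + real m * s \<and>
      ((\<exists>k\<le>m. r x = a + real k * s) \<or> (\<exists>j<m. \<bar>x - cen j\<bar> < t))) \<and>
    (\<forall>j<m. \<forall>x. \<bar>x - cen j\<bar> \<le> t \<longrightarrow> r x = cen j + s / (2 * t) * (x - cen j))"
proof -
  have s: "s > 0" using t by simp
  define M where "M = s / (2 * t)"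
  have M: "M > 0" "M * t = s / 2" using s t by (simp_all add: M_def)
  \<comment> \<open>The profile of one step: it rises from 0 to \<open>s\<close> with slope
    \<open>M\<close> between \<open>- t\<close> and \<open>t\<close> and is constant
    elsewhere.\<close>
  define \<kappa> where "\<kappa> v = max 0 (min s (M * v + s / 2))" for v :: real
  have Mm: "M * v \<le> M * w" if "v \<le> w" for v w using that M(1) by simp
  have k0: "\<kappa> v = 0" if "v \<le> - t" for v
    using Mm[OF that] M s by (simp add: \<kappa>_def)
  have k1: "\<kappa> v = s" if "v \<ge> t" for v
    using Mm[OF that] M s by (simp add: \<kappa>_def)
  have kmid: "\<kappa> v = M * v + s / 2" if "\<bar>v\<bar> \<le> t" for v
    using Mm[of v t] Mm[of "- t" v] that M by (simp add: \<kappa>_def abs_le_iff)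
  have kb: "0 \<le> \<kappa> v" "\<kappa> v \<le> s" for v using s by (auto simp: \<kappa>_def)
  define r where "r x = a + (\<Sum>j<m. \<kappa> (x - cen j))" for x
  have cell: "r x = a + real j * s + \<kappa> (x - cen j)" if j: "j < m" "\<bar>x - cen j\<bar> \<le> s / 2" for x j
  proof -
    have jb: "- (s / 2) \<le> x - cen j" "x - cen j \<le> s / 2" using j(2) by linarith+
    \<comment> \<open>On cell \<open>j\<close> all earlier steps are complete and no later one has
      begun, since \<open>t < s / 2\<close>.\<close>
    have "(\<Sum>i<m. \<kappa> (x - cen i)) = (\<Sum>i<m. (if i < j then s else 0) + (if i = j then \<kappa> (x - cen j) else 0))"
    proof (rule sum.cong)
      fix i assume "i \<in> {..<m}"
      consider "i < j" | "i = j" | "j < i" by linarith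
      then show "\<kappa> (x - cen i) = (if i < j then s else 0) + (if i = j then \<kappa> (x - cen j) else 0)"
      proof cases
        case 1
        then have "(real i + 1) * s \<le> real j * s" using s by (intro mult_right_mono) auto
        then have "x - cen i \<ge> t" using jb t by (simp add: cen_def algebra_simps)
        then show ?thesis using 1 k1 by simp
      next
        case 3
        then have "(real j + 1) * s \<le> real i * s" using s by (intro mult_right_mono) auto
        then have "x - cen i \<le> - t" using jb t by (simp add: cen_def algebra_simps)
        then show ?thesis using 3 k0 by simp
      qed simp
    qed simp
    also have "\<dots> = (\<Sum>i<m. if i < j then s else 0) + \<kappa> (x - cen j)"
      using j(1) by (simp add: sum.distrib)
    also have "(\<Sum>i<m. if i < j then s else 0) = (\<Sum>i<j. s)"
    proof -
      have "{..<m} \<inter> {i. i < j} = {..<j}" using j(1) by auto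
      then show ?thesis by (simp add: sum.If_cases)
    qed
    finally show ?thesis by (simp add: r_def)
  qed
  have "continuous_on UNIV r" unfolding r_def \<kappa>_def by (intro continuous_intros)
  moreover have "\<bar>r x - x\<bar> \<le> s \<and> a \<le> r x \<and> r x \<le> a + real m * s \<and>
      ((\<exists>k\<le>m. r x = a + real k * s) \<or> (\<exists>j<m. \<bar>x - cen j\<bar> < t))"
    if x: "a \<le> x" "x \<le> a + real m * s" for x
  proof -
    obtain j where j: "j < m" "a + real j * s \<le> x" "x \<le> a + (real j + 1) * s"
    proof (cases "x = a + real m * s")
      case True
      \<comment> \<open>The right end point is assigned to the last cell; rounding down would give
        the index \<open>m\<close>.\<close>
      then show ?thesis using that[of "m - 1"] m s by (simp add: of_nat_diff algebra_simps)
    next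
      case False
      define j where "j = nat \<lfloor>(x - a) / s\<rfloor>"
      have q: "0 \<le> (x - a) / s" "(x - a) / s < real m"
        using x False s by (auto simp: pos_divide_less_eq algebra_simps)
      have rj: "real j = of_int \<lfloor>(x - a) / s\<rfloor>" using q(1) by (simp add: j_def)
      have "real j \<le> (x - a) / s" "(x - a) / s < real j + 1" unfolding rj by linarith+
      then have "real j * s \<le> x - a" "x - a < (real j + 1) * s"
        using s by (simp_all add: pos_le_divide_eq pos_divide_less_eq)
      moreover have "real j < real m" using \<open>real j \<le> (x - a) / s\<close> q(2) by linarith
      ultimately have "real j * s \<le> x - a" "x - a < (real j + 1) * s" "j < m" by auto
      then show ?thesis by (intro that[of j]) auto
    qed
    have "x - cen j \<le> s / 2" "- (s / 2) \<le> x - cen j"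
      using j(2,3) by (simp_all add: cen_def algebra_simps)
    then have "\<bar>x - cen j\<bar> \<le> s / 2" by linarith
    then have rx: "r x = a + real j * s + \<kappa> (x - cen j)" using cell j(1) by blast
    have "(real j + 1) * s \<le> real m * s" using j(1) s by (intro mult_right_mono) auto
    then have "\<bar>r x - x\<bar> \<le> s" "a \<le> r x" "r x \<le> a + real m * s"
      unfolding rx using kb[of "x - cen j"] j(2,3) s mult_nonneg_nonneg[of "real j" s]
      by (auto simp: distrib_right abs_le_iff)
    moreover have "(\<exists>k\<le>m. r x = a + real k * s) \<or> (\<exists>j<m. \<bar>x - cen j\<bar> < t)"
    proof -
      consider "x - cen j \<le> - t" | "t \<le> x - cen j" | "\<bar>x - cen j\<bar> < t" by linarith
      then show ?thesis
      proof cases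
        case 1
        then have "r x = a + real j * s" using rx k0 by simp
        then show ?thesis using j(1) by (meson less_imp_le)
      next
        case 2
        then have "r x = a + real (Suc j) * s" using rx k1 by (simp add: algebra_simps)
        then show ?thesis using j(1) by (meson Suc_leI)
      next
        case 3
        then show ?thesis using j(1) by blast
      qed
    qed
    ultimately show ?thesis by blast
  qed
  moreover have "r x = cen j + s / (2 * t) * (x - cen j)" if "j < m" "\<bar>x - cen j\<bar> \<le> t" for x j
  proof -
    have "r x = a + real j * s + \<kappa> (x - cen j)" using cell that t by simp
    also have "\<dots> = cen j + s / (2 * t) * (x - cen j)"
      using kmid[OF that(2)] by (simp add: cen_def M_def algebra_simps)
    finally show ?thesis .
  qed
  ultimately show ?thesis by blast
qed

text \<open>Let \<open>y = u x\<close> be far from the grid hyperplanes. Then every coordinate of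
  \<open>f1 x\<close> is within \<open>t\<close> of the centre of an interval, so a small translate
  of \<open>f1\<close> hits the corresponding centre \<open>c\<close>. Hence \<open>c\<close> is not
  among the missed centres and must be stable. Reaching any \<open>y'\<close> near \<open>y\<close>
  reduces to hitting \<open>c\<close>, so \<open>y\<close> is an interior point.\<close>

lemma thin_frontier_approximation:
  fixes f :: "'a::metric_space \<Rightarrow> real^'n::finite"
  assumes K: "compact K" and f: "continuous_on K f" and h: "gauge_function h"
    and lim: "((\<lambda>r. h r / r ^ (CARD('n) - 1)) \<longlongrightarrow> 0) (at_right 0)"
    and pos: "e > 0" "\<delta> > 0" "\<epsilon> > 0"
  shows "\<exists>g d. continuous_on K g \<and> (\<forall>x\<in>K. dist (f x) (g x) \<le> e) \<and> d > 0 \<and>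
    (\<forall>u. continuous_on K u \<longrightarrow> (\<forall>x\<in>K. dist (g x) (u x) < d) \<longrightarrow>
      hausdorff_premeasure h \<delta> (frontier (u ` K)) < ennreal \<epsilon>)"
proof -
  let ?n = "real CARD('n)"
  have n: "?n > 0" by simp
  \<comment> \<open>Applying \<open>r\<close> in every coordinate moves a point by at most
    \<open>n * s = e / 2\<close>; the other half of \<open>e\<close> is spent on
    \<open>f1\<close>.\<close>
  define s where "s = e / (2 * ?n)"
  have s: "s > 0" "?n * s = e / 2" using pos(1) n by (simp_all add: s_def)
  obtain R0 where R0: "\<And>x. x \<in> K \<Longrightarrow> norm (f x) \<le> R0"
    using compact_imp_bounded[OF compact_continuous_image[OF f K]] unfolding bounded_iff by blast
  \<comment> \<open>The cube of half-side \<open>N * s\<close> will contain \<open>f1(K)\<close>,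
    because \<open>f1\<close> stays within 1 of \<open>f\<close>.\<close>
  obtain N where N: "max (R0 + 1) s / s < real N" using reals_Archimedean2 by blast
  then have N: "max (R0 + 1) s < real N * s" using s(1) by (simp add: pos_divide_less_eq)
  then have Ns: "R0 + 1 < real N * s" "0 < real N * s" using s(1) by auto
  then have N0: "2 * N > 0" using s(1) by (simp add: zero_less_mult_iff)
  define a where "a = - (real N * s)"
  have aN: "a + real (2 * N) * s = real N * s" by (simp add: a_def algebra_simps)
  define cen where "cen j = a + (real j + 1 / 2) * s" for j :: nat
  define \<Gamma> where "\<Gamma> = {v :: real^'n. \<forall>i. v $ i \<in> cen ` {..<2 * N}}"
  have "\<Gamma> \<subseteq> vec_lambda ` (PiE UNIV (\<lambda>_. cen ` {..<2 * N}))"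
  proof
    fix v assume "v \<in> \<Gamma>"
    then show "v \<in> vec_lambda ` (PiE UNIV (\<lambda>_. cen ` {..<2 * N}))"
      by (intro image_eqI[of _ _ "\<lambda>i. v $ i"]) (auto simp: \<Gamma>_def)
  qed
  moreover have "finite (PiE (UNIV :: 'n set) (\<lambda>_. cen ` {..<2 * N}))" by (intro finite_PiE) auto
  ultimately have fin: "finite \<Gamma>" by (meson finite_imageI finite_subset)
  obtain f1 \<eta> where f1: "continuous_on K f1" "\<And>x. x \<in> K \<Longrightarrow> dist (f x) (f1 x) < min (e / 2) 1" "\<eta> > 0"
    "\<And>c. c \<in> \<Gamma> \<Longrightarrow> (\<forall>u. continuous_on K u \<and> (\<forall>x\<in>K. dist (f1 x) (u x) < \<eta>) \<longrightarrow> c \<notin> u ` K) \<or>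
           (\<forall>u. continuous_on K u \<and> (\<forall>x\<in>K. dist (f1 x) (u x) < \<eta>) \<longrightarrow> c \<in> u ` K)"
    using avoid_or_stable[OF K f fin, of "min (e / 2) 1"] pos(1) by auto
  \<comment> \<open>A shift of \<open>f1\<close> by at most \<open>t\<close> in each coordinate
    costs at most \<open>n * t < \<eta> / 2\<close>, and \<open>t < s / 2\<close> makes the factor
    \<open>M\<close> at least 1.\<close>
  define t where "t = min (s / 4) (\<eta> / (4 * ?n))"
  have t: "0 < t" "t < s / 2" "t \<le> s / 4" "?n * t < \<eta> / 2"
  proof -
    show "0 < t" "t < s / 2" "t \<le> s / 4" using s(1) f1(3) n by (auto simp: t_def)
    have "?n * t \<le> ?n * (\<eta> / (4 * ?n))" using n by (intro mult_left_mono) (auto simp: t_def)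
    also have "\<dots> = \<eta> / 4" using n by simp
    finally show "?n * t < \<eta> / 2" using f1(3) by linarith
  qed
  define M where "M = s / (2 * t)"
  have M: "M \<ge> 1" "M * t = s / 2" using s(1) t by (simp_all add: M_def pos_le_divide_eq)
  obtain r where cr: "continuous_on UNIV r" and r:
    "\<And>x. a \<le> x \<Longrightarrow> x \<le> a + real (2 * N) * s \<Longrightarrow> \<bar>r x - x\<bar> \<le> s \<and> a \<le> r x \<and> r x \<le> a + real (2 * N) * s \<and>
      ((\<exists>k\<le>2 * N. r x = a + real k * s) \<or> (\<exists>j<2 * N. \<bar>x - cen j\<bar> < t))"
    "\<And>j x. j < 2 * N \<Longrightarrow> \<bar>x - cen j\<bar> \<le> t \<Longrightarrow> r x = cen j + M * (x - cen j)"
    using expanding_staircase[OF t(1,2) N0, of a] unfolding cen_def M_def by blast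
  define g where "g x = (\<chi> i. r (f1 x $ i))" for x
  have cg: "continuous_on K g" unfolding g_def
    by (intro continuous_on_vec_lambda continuous_on_compose2[OF cr]) (use f1(1) in \<open>auto intro!: continuous_intros\<close>)
  have f1b: "a \<le> f1 x $ i" "f1 x $ i \<le> a + real (2 * N) * s" if "x \<in> K" for x i
  proof -
    have "norm (f1 x) \<le> norm (f x) + dist (f x) (f1 x)"
      using norm_triangle_ineq4[of "f x" "f x - f1 x"] by (simp add: dist_norm)
    then have "norm (f1 x) \<le> real N * s" using R0[OF that] f1(2)[OF that] Ns(1) by simp
    then have "\<bar>f1 x $ i\<bar> \<le> real N * s" using component_le_norm_cart order_trans by blast
    then show "a \<le> f1 x $ i" "f1 x $ i \<le> a + real (2 * N) * s" unfolding aN a_def by linarith+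
  qed
  note rf = r(1)[OF f1b]
  have fg: "dist (f x) (g x) \<le> e" if x: "x \<in> K" for x
  proof -
    have "norm (g x - f1 x) \<le> ?n * s"
      by (rule norm_le_card_mult) (use rf[OF x x] in \<open>simp add: g_def\<close>)
    then have "dist (f1 x) (g x) \<le> e / 2" using s(2) by (simp add: dist_norm norm_minus_commute)
    then show ?thesis using f1(2)[OF x] dist_triangle[of "f x" "g x" "f1 x"] by simp
  qed
  define G where "G = (\<lambda>k. a + real k * s) ` {..2 * N}"
  obtain \<tau>0 where \<tau>0: "\<tau>0 > 0" "\<And>\<tau>. 0 < \<tau> \<Longrightarrow> \<tau> < \<tau>0 \<Longrightarrow>
    hausdorff_premeasure h \<delta> {y :: real^'n. (\<forall>i. \<bar>y $ i\<bar> \<le> real N * s + 1) \<and> (\<exists>i. \<exists>\<gamma>\<in>G. \<bar>y $ i - \<gamma>\<bar> \<le> 2 * \<tau>)} < ennreal \<epsilon>"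
    using hausdorff_premeasure_grid_neighbourhood[of G "real N * s + 1" h \<delta> \<epsilon>, OF _ _ h lim pos(2,3)] Ns(2)
    unfolding G_def by auto
  \<comment> \<open>The term \<open>\<eta> / 4\<close> leaves room for the perturbation
    \<open>(u - g) / M\<close>; the term 1 keeps \<open>u(K)\<close> in the cube of half-side
    \<open>N * s + 1\<close>.\<close>
  define \<tau> where "\<tau> = min (\<tau>0 / 2) (min 1 (\<eta> / 4))"
  have \<tau>: "0 < \<tau>" "\<tau> < \<tau>0" "\<tau> \<le> 1" "\<tau> \<le> \<eta> / 4" using \<tau>0(1) f1(3) by (auto simp: \<tau>_def)
  have "hausdorff_premeasure h \<delta> (frontier (u ` K)) < ennreal \<epsilon>"
    if u: "continuous_on K u" "\<And>x. x \<in> K \<Longrightarrow> dist (g x) (u x) < \<tau>" for u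
  proof -
    have ug: "\<bar>u x $ i - g x $ i\<bar> < \<tau>" if "x \<in> K" for x i
      using component_le_norm_cart[of "u x - g x" i] u(2)[OF that]
      by (simp add: dist_norm norm_minus_commute)
    have "frontier (u ` K) \<subseteq> {y :: real^'n. (\<forall>i. \<bar>y $ i\<bar> \<le> real N * s + 1) \<and> (\<exists>i. \<exists>\<gamma>\<in>G. \<bar>y $ i - \<gamma>\<bar> \<le> 2 * \<tau>)}"
    proof
      fix y assume y: "y \<in> frontier (u ` K)"
      have "closed (u ` K)" using compact_continuous_image[OF u(1) K] by (rule compact_imp_closed)
      then obtain x where x: "x \<in> K" "y = u x" using y frontier_subset_closed by blast
      have yg: "\<bar>y $ i - g x $ i\<bar> < \<tau>" for i using ug[OF x(1)] x(2) by simp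
      have "\<bar>y $ i\<bar> \<le> real N * s + 1" for i
      proof -
        have "a \<le> g x $ i" "g x $ i \<le> a + real (2 * N) * s" using rf[OF x(1) x(1), of i] by (simp_all add: g_def)
        then show ?thesis using yg[of i] \<tau>(3) unfolding aN a_def by linarith
      qed
      moreover have "\<exists>i. \<exists>\<gamma>\<in>G. \<bar>y $ i - \<gamma>\<bar> \<le> 2 * \<tau>"
      proof (rule ccontr)
        assume "\<not> ?thesis"
        then have far: "\<bar>y $ i - \<gamma>\<bar> > 2 * \<tau>" if "\<gamma> \<in> G" for i \<gamma> using that by (meson not_le)
        have "\<exists>j<2 * N. \<bar>f1 x $ i - cen j\<bar> < t" for i
        proof -
          have "g x $ i \<notin> G" using far[of "g x $ i" i] yg[of i] \<tau>(1) by auto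
          then have "\<not> (\<exists>k\<le>2 * N. r (f1 x $ i) = a + real k * s)" by (auto simp: G_def g_def)
          then show ?thesis using rf[OF x(1) x(1), of i] by blast
        qed
        then obtain j where j: "\<And>i. j i < 2 * N" "\<And>i. \<bar>f1 x $ i - cen (j i)\<bar> < t" by metis
        define c where "c = (\<chi> i. cen (j i))"
        have ci: "c $ i = cen (j i)" for i by (simp add: c_def)
        have c\<Gamma>: "c \<in> \<Gamma>" using j(1) by (simp add: \<Gamma>_def ci)
        have gx: "g x $ i = c $ i + M * (f1 x $ i - c $ i)" for i
          using r(2)[OF j(1), of "f1 x $ i" i] j(2)[of i] by (simp add: g_def ci)
        \<comment> \<open>\<open>g x\<close> is inside the cell of \<open>c\<close> and
          \<open>y\<close> is within \<open>\<tau>\<close> of it. The faces of the cell belong to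
          the grid, so \<open>y\<close> is inside the cell as well, more than
          \<open>2 * \<tau>\<close> from each face.\<close>
        have yc: "\<bar>y $ i - c $ i\<bar> < s / 2 - 2 * \<tau>" for i
        proof -
          have "\<bar>M * (f1 x $ i - c $ i)\<bar> < M * t"
            using j(2)[of i] M(1) by (simp add: abs_mult ci)
          then have "\<bar>g x $ i - c $ i\<bar> < s / 2" using gx[of i] M(2) by simp
          moreover have "c $ i - s / 2 = a + real (j i) * s" "c $ i + s / 2 = a + real (Suc (j i)) * s"
            by (simp_all add: ci cen_def algebra_simps)
          moreover have "a + real (j i) * s \<in> G" "a + real (Suc (j i)) * s \<in> G"
            unfolding G_def using j(1)[of i] by (intro imageI; simp)+
          ultimately have "\<bar>g x $ i - c $ i\<bar> < s / 2" "c $ i - s / 2 \<in> G" "c $ i + s / 2 \<in> G"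
            by simp_all
          moreover from this have "\<bar>y $ i - (c $ i - s / 2)\<bar> > 2 * \<tau>" "\<bar>y $ i - (c $ i + s / 2)\<bar> > 2 * \<tau>" using far by auto
          ultimately show ?thesis using yg[of i] by linarith
        qed
        \<comment> \<open>The translate \<open>w\<close> of \<open>f1\<close> takes the value
          \<open>c\<close> at \<open>x\<close>, which rules out that all maps near \<open>f1\<close>
          miss \<open>c\<close>.\<close>
        have stable: "c \<in> v ` K" if "continuous_on K v" "\<forall>z\<in>K. dist (f1 z) (v z) < \<eta>" for v
        proof -
          define w where "w z = f1 z + (c - f1 x)" for z
          have "norm (c - f1 x) \<le> ?n * t"
            by (rule norm_le_card_mult) (use j(2) in \<open>auto simp: ci abs_minus_commute less_imp_le\<close>)
          then have "norm (f1 x - c) < \<eta>" using t(4) f1(3) by (simp add: norm_minus_commute)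
          then have "\<forall>z\<in>K. dist (f1 z) (w z) < \<eta>" by (simp add: w_def dist_norm)
          moreover have "continuous_on K w" unfolding w_def using f1(1) by (intro continuous_intros)
          moreover have "c \<in> w ` K" using x(1) by (intro image_eqI[of _ _ x]) (simp_all add: w_def)
          ultimately show ?thesis using f1(4)[OF c\<Gamma>] that by blast
        qed
        have "ball y \<tau> \<subseteq> u ` K"
        proof
          fix y' assume "y' \<in> ball y \<tau>"
          then have y'y: "\<bar>y' $ i - y $ i\<bar> < \<tau>" for i
            using component_le_norm_cart[of "y' - y" i] by (simp add: dist_norm norm_minus_commute)
          \<comment> \<open>\<open>c + p\<close> is the point that stretching by \<open>M\<close>
            around \<open>c\<close> sends to \<open>y'\<close>.\<close>
          define p where "p = (1 / M) *\<^sub>R (y' - c)"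
          have Mp: "M * p $ i = y' $ i - c $ i" for i using M(1) by (simp add: p_def)
          have Mpa: "M * \<bar>p $ i\<bar> = \<bar>y' $ i - c $ i\<bar>" for i
            using M(1) by (simp add: Mp[symmetric] abs_mult)
          have p: "M * \<bar>p $ i\<bar> < M * t - \<tau>" for i
            using Mpa[of i] y'y[of i] yc[of i] M(2) by linarith
          txt \<open>Perturbing \<open>f1\<close> by \<open>(u - g) / M\<close> makes \<open>g\<close> into \<open>u\<close> where \<open>r\<close> stretches by the factor \<open>M\<close>.\<close>
          define v where "v z = f1 z + (1 / M) *\<^sub>R (u z - g z) - p" for z
          have "continuous_on K v" unfolding v_def using f1(1) u(1) cg by (intro continuous_intros)
          moreover have "dist (f1 z) (v z) < \<eta>" if z: "z \<in> K" for z
          proof -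
            have "norm p \<le> ?n * t"
            proof (rule norm_le_card_mult)
              fix i
              have "M * \<bar>p $ i\<bar> \<le> M * t" using p[of i] \<tau>(1) by linarith
              then show "\<bar>p $ i\<bar> \<le> t" using M(1) by simp
            qed
            moreover have "norm ((1 / M) *\<^sub>R (u z - g z)) \<le> \<tau>"
            proof -
              have "norm ((1 / M) *\<^sub>R (u z - g z)) = norm (u z - g z) / M" using M(1) by simp
              also have "\<dots> \<le> norm (u z - g z) / 1" using M(1) by (intro divide_left_mono) auto
              finally show ?thesis using u(2)[OF z] by (simp add: dist_norm norm_minus_commute)
            qed
            moreover have "dist (f1 z) (v z) = norm (p - (1 / M) *\<^sub>R (u z - g z))"
              by (simp add: v_def dist_norm)
            ultimately show ?thesis
              using norm_triangle_ineq4[of p "(1 / M) *\<^sub>R (u z - g z)"] t(4) \<tau>(4) f1(3) by linarith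
          qed
          ultimately obtain z where z: "z \<in> K" "c = v z" using stable by blast
          \<comment> \<open>The margin \<open>\<tau>\<close> in the bound for \<open>p\<close>
            absorbs \<open>u - g\<close>, so \<open>f1 z\<close> lies in the inner cube around
            \<open>c\<close>. There \<open>r\<close> is affine with slope \<open>M\<close>, and
            \<open>v z = c\<close> unwinds to \<open>u z = y'\<close>.\<close>
          have "u z $ i = y' $ i" for i
          proof -
            have "c $ i = f1 z $ i + (1 / M) * (u z $ i - g z $ i) - p $ i"
              using z(2) by (simp add: v_def)
            then have "M * (c $ i) = M * (f1 z $ i) + (u z $ i - g z $ i) - M * p $ i"
              using M(1) by (simp add: field_simps)
            then have eq: "M * (f1 z $ i - c $ i) = M * p $ i - (u z $ i - g z $ i)"
              by (simp add: algebra_simps)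
            have "M * \<bar>f1 z $ i - c $ i\<bar> = \<bar>M * (f1 z $ i - c $ i)\<bar>" using M(1) by (simp add: abs_mult)
            also have "\<dots> \<le> \<bar>M * p $ i\<bar> + \<bar>u z $ i - g z $ i\<bar>" unfolding eq by linarith
            also have "\<dots> \<le> M * t" using p[of i] ug[OF z(1), of i] M(1) by (simp add: abs_mult)
            finally have "\<bar>f1 z $ i - c $ i\<bar> \<le> t" using M(1) by simp
            then have "g z $ i = c $ i + M * (f1 z $ i - c $ i)"
              using r(2)[OF j(1), of "f1 z $ i" i] by (simp add: g_def ci)
            then show ?thesis using eq Mp[of i] by linarith
          qed
          then have "u z = y'" by (simp add: vec_eq_iff)
          then show "y' \<in> u ` K" using z(1) by blast
        qed
        then have "y \<in> interior (u ` K)" using \<tau>(1) mem_interior by blast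
        then show False using y by (simp add: frontier_def)
      qed
      ultimately show "y \<in> {y :: real^'n. (\<forall>i. \<bar>y $ i\<bar> \<le> real N * s + 1) \<and> (\<exists>i. \<exists>\<gamma>\<in>G. \<bar>y $ i - \<gamma>\<bar> \<le> 2 * \<tau>)}"
        by blast
    qed
    then have "hausdorff_premeasure h \<delta> (frontier (u ` K)) \<le> hausdorff_premeasure h \<delta>
        {y :: real^'n. (\<forall>i. \<bar>y $ i\<bar> \<le> real N * s + 1) \<and> (\<exists>i. \<exists>\<gamma>\<in>G. \<bar>y $ i - \<gamma>\<bar> \<le> 2 * \<tau>)}"
      by (rule hausdorff_premeasure_mono)
    also have "\<dots> < ennreal \<epsilon>" using \<tau>0(2) \<tau>(1,2) by blast
    finally show ?thesis .
  qed
  then show ?thesis using cg fg \<tau>(1) by (intro exI[of _ g] exI[of _ \<tau>]) blast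
qed

text \<open>Scale and bound are both taken to be \<open>1 / (k + 1)\<close>. Since the premeasure
  can only grow as the scale shrinks, these countably many conditions together force it to vanish at
  every scale.\<close>

lemma generic_map_hausdorff_measure_frontier_zero:
  fixes K :: "'a::metric_space set"
  assumes K: "compact K" and h: "gauge_function h"
    and lim: "((\<lambda>r. h r / r ^ (CARD('n::finite) - 1)) \<longlongrightarrow> 0) (at_right 0)"
  shows "generic_map K (\<lambda>f :: 'a \<Rightarrow> real^'n. hausdorff_measure h (frontier (f ` K)) = 0)"
proof -
  define q where "q k = 1 / real (Suc k)" for k
  have q: "q k > 0" for k by (simp add: q_def)
  have "generic_map K (\<lambda>f :: 'a \<Rightarrow> real^'n. hausdorff_premeasure h (q k) (frontier (f ` K)) < ennreal (q k))" for k
    by (rule generic_mapI[OF K]) (rule thin_frontier_approximation[OF K _ h lim _ q q])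
  then have "generic_map K (\<lambda>f :: 'a \<Rightarrow> real^'n. \<forall>k. hausdorff_premeasure h (q k) (frontier (f ` K)) < ennreal (q k))"
    by (rule generic_map_countable)
  then show ?thesis
  proof (rule generic_map_mono)
    fix f :: "'a \<Rightarrow> real^'n"
    assume f: "\<forall>k. hausdorff_premeasure h (q k) (frontier (f ` K)) < ennreal (q k)"
    have eps: "hausdorff_premeasure h \<delta> (frontier (f ` K)) \<le> 0 + ennreal e" if \<delta>: "\<delta> > 0" and e: "e > 0" for \<delta> e
    proof -
      have "min \<delta> e > 0" using \<delta> e by simp
      then obtain k where "q k < min \<delta> e" unfolding q_def by (rule nat_approx_posE)
      then have k: "q k \<le> \<delta>" "q k \<le> e" by auto
      have "hausdorff_premeasure h \<delta> (frontier (f ` K)) \<le> hausdorff_premeasure h (q k) (frontier (f ` K))"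
        using k(1) by (rule hausdorff_premeasure_antimono)
      also have "\<dots> \<le> ennreal (q k)" using f by (simp add: less_imp_le)
      also have "\<dots> \<le> ennreal e" using k(2) by (rule ennreal_leI)
      finally show ?thesis by simp
    qed
    have le0: "hausdorff_premeasure h \<delta> (frontier (f ` K)) \<le> 0" if \<delta>: "\<delta> > 0" for \<delta>
    proof (rule ennreal_le_epsilon)
      fix e :: real assume "0 < e"
      then show "hausdorff_premeasure h \<delta> (frontier (f ` K)) \<le> 0 + ennreal e" by (rule eps[OF \<delta>])
    qed
    have "hausdorff_measure h (frontier (f ` K)) \<le> 0"
      unfolding hausdorff_measure_eq_SUP by (rule SUP_least, rule le0, simp)
    then show "hausdorff_measure h (frontier (f ` K)) = 0" by simp
  qed
qed

theorem theorem6p1: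
  fixes K :: "'a::metric_space set"
  assumes "compact K"
    and "dim_T K \<ge> ereal (real CARD('n::finite))"
  shows
    "generic_map K (\<lambda>f :: 'a \<Rightarrow> real ^ 'n.
        dim_T (frontier (f ` K)) = ereal (real CARD('n) - 1) \<and>
        dim_H (frontier (f ` K)) = ereal (real CARD('n) - 1))
     \<and> (\<forall>h. gauge_function h \<and> ((\<lambda>r. h r / r ^ (CARD('n) - 1)) \<longlongrightarrow> 0) (at_right 0) \<longrightarrow>
          generic_map K (\<lambda>f :: 'a \<Rightarrow> real ^ 'n.
            hausdorff_measure h (frontier (f ` K)) = 0 \<and>
            hausdorff_measure (power_gauge (real CARD('n) - 1)) (frontier (f ` K)) > 0))"
proof (intro conjI allI impI)
  note K = assms(1)
  let ?s = "real CARD('n) - 1"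
  have s: "?s = real (CARD('n) - 1)" by (simp add: of_nat_diff Suc_leI)
  have "\<not> top_of_set K dim_le (int CARD('n) - 1)"
  proof
    assume "top_of_set K dim_le (int CARD('n) - 1)"
    then have "dim_T K \<le> ereal (of_int (int CARD('n) - 1))"
      unfolding small_ind_dim_def by (intro INF_lower) simp
    with assms(2) have "ereal (real CARD('n)) \<le> ereal (of_int (int CARD('n) - 1))" by (rule order_trans)
    then show False by simp
  qed
  then have int: "generic_map K (\<lambda>f :: 'a \<Rightarrow> real^'n. interior (f ` K) \<noteq> {})"
    by (rule generic_map_interior_nonempty[OF K])
  have cK: "compact (f ` K)" if "continuous_on K f" for f :: "'a \<Rightarrow> real^'n"
    using that K by (rule compact_continuous_image)
  \<comment> \<open>The exponents decrease to n - 1, so the vanishing of these countably many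
    measures bounds the Hausdorff dimension by n - 1.\<close>
  have "generic_map K (\<lambda>f :: 'a \<Rightarrow> real^'n. hausdorff_measure (power_gauge (?s + 1 / real (Suc k))) (frontier (f ` K)) = 0)" for k
    unfolding s
    by (intro generic_map_hausdorff_measure_frontier_zero K gauge_function_power_gauge power_gauge_quotient_tendsto_0) auto
  then have "generic_map K (\<lambda>f :: 'a \<Rightarrow> real^'n. \<forall>k. hausdorff_measure (power_gauge (?s + 1 / real (Suc k))) (frontier (f ` K)) = 0)"
    by (rule generic_map_countable)
  from generic_map_conj[OF int this]
  show "generic_map K (\<lambda>f :: 'a \<Rightarrow> real ^ 'n.
        dim_T (frontier (f ` K)) = ereal ?s \<and> dim_H (frontier (f ` K)) = ereal ?s)"
  proof (rule generic_map_mono_on[OF K], intro conjI)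
    fix f :: "'a \<Rightarrow> real^'n"
    assume f: "continuous_on K f" "interior (f ` K) \<noteq> {} \<and>
      (\<forall>k. hausdorff_measure (power_gauge (?s + 1 / real (Suc k))) (frontier (f ` K)) = 0)"
    show "dim_T (frontier (f ` K)) = ereal ?s"
      using dim_T_frontier[OF cK[OF f(1)]] f(2) by blast
    show "dim_H (frontier (f ` K)) = ereal ?s"
    proof (rule antisym)
      have "0 \<le> ?s" unfolding s by simp
      then show "dim_H (frontier (f ` K)) \<le> ereal ?s"
        by (rule dim_H_le) (rule f(2)[THEN conjunct2, THEN spec])
      show "ereal ?s \<le> dim_H (frontier (f ` K))"
        using hausdorff_measure_frontier_pos[OF cK[OF f(1)]] f(2) by (blast intro: dim_H_ge)
    qed
  qed
  fix h :: "real \<Rightarrow> real"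
  assume h: "gauge_function h \<and> ((\<lambda>r. h r / r ^ (CARD('n) - 1)) \<longlongrightarrow> 0) (at_right 0)"
  have "generic_map K (\<lambda>f :: 'a \<Rightarrow> real^'n. hausdorff_measure h (frontier (f ` K)) = 0)"
    by (rule generic_map_hausdorff_measure_frontier_zero[OF K h[THEN conjunct1] h[THEN conjunct2]])
  from generic_map_conj[OF int this]
  show "generic_map K (\<lambda>f :: 'a \<Rightarrow> real ^ 'n. hausdorff_measure h (frontier (f ` K)) = 0 \<and>
            hausdorff_measure (power_gauge ?s) (frontier (f ` K)) > 0)"
  proof (rule generic_map_mono_on[OF K])
    fix f :: "'a \<Rightarrow> real^'n"
    assume f: "continuous_on K f" "interior (f ` K) \<noteq> {} \<and> hausdorff_measure h (frontier (f ` K)) = 0"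
    show "hausdorff_measure h (frontier (f ` K)) = 0 \<and> hausdorff_measure (power_gauge ?s) (frontier (f ` K)) > 0"
      using hausdorff_measure_frontier_pos[OF cK[OF f(1)]] f(2) by blast
  qed
qed

end
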